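(* Under the Setup and the Unconditional asymptotic regime described in the context, for $i=0,1$, $$\lim_{p\to\infty} E_{\boldsymbol\mu,S_n}[\hat\varepsilon_i^B]=\Phi\!\left((-1)^i\,\frac{-H_i+c}{\sqrt F}\right),$$ and consequently $$\lim_{p\to\infty} E_{\boldsymbol\mu,S_n}[\hat\varepsilon^B]=\alpha_0\,\Phi\!\left(\frac{-H_0+c}{\sqrt F}\right)+\alpha_1\,\Phi\!\left(\frac{H_1-c}{\sqrt F}\right),$$ where $H_0=\frac12\big(\bar\Delta^2_{\mathbf m}+J_1-J_0+\frac{J_0}{\gamma_0}+\frac{J_1}{\gamma_1}\big)$, $H_1=-\frac12\big(\bar\Delta^2_{\mathbf m}+J_0-J_1+\frac{J_0}{\gamma_0}+\frac{J_1}{\gamma_1}\big)$, and $F=\bar\Delta^2_{\mathbf m}+J_0+J_1+\frac{J_0}{\gamma_0}+\frac{J_1}{\gamma_1}$.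
   Context: Setup. Fix $\alpha_0\in(0,1)$, $\alpha_1=1-\alpha_0$, and $c=\log\frac{1-\alpha_0}{\alpha_0}$. $\Phi$ is the standard normal CDF. For each dimension $p$ there is a known symmetric positive definite $p\times p$ matrix $\Sigma$, sample sizes $n_0,n_1$, prior means $\mathbf m_0,\mathbf m_1\in\mathbb R^p$ and prior certainty parameters $\nu_0,\nu_1>0$ (all depending on $p$; the index $p$ is suppressed). The class means are random: $\boldsymbol\mu_i\sim N(\mathbf m_i,\Sigma/\nu_i)$, $i=0,1$, independent; $\boldsymbol\mu=(\boldsymbol\mu_0,\boldsymbol\mu_1)$. Given $\boldsymbol\mu$, class $i$ has distribution $\Pi_i=N(\boldsymbol\mu_i,\Sigma)$, and the sample $S_n$ consists of $n_0$ i.i.d. points from $\Pi_0$ and, independently, $n_1$ i.i.d. points from $\Pi_1$; $\bar{\mathbf x}_0,\bar{\mathbf x}_1$ are the class sample means. The LDA classifier assigns $\mathbf x$ to class 1 if $W(\mathbf x)\le c$ and to class 0 otherwise, where $W(\mathbf x)=(\mathbf x-\frac{\bar{\mathbf x}_0+\bar{\mathbf x}_1}{2})^T\Sigma^{-1}(\bar{\mathbf x}_0-\bar{\mathbf x}_1)$. Let $\hat\delta^2=(\bar{\mathbf x}_0-\bar{\mathbf x}_1)^T\Sigma^{-1}(\bar{\mathbf x}_0-\bar{\mathbf x}_1)$. The true error is $\varepsilon=\alpha_0\varepsilon_0+\alpha_1\varepsilon_1$ with $\varepsilon_i=\Phi\Big(\frac{(-1)^{i+1}(\boldsymbol\mu_i-\frac{\bar{\mathbf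 x}_0+\bar{\mathbf x}_1}{2})^T\Sigma^{-1}(\bar{\mathbf x}_0-\bar{\mathbf x}_1)+(-1)^i c}{\hat\delta}\Big)$. The Bayesian MMSE error estimator is $\hat\varepsilon^B=\alpha_0\hat\varepsilon^B_0+\alpha_1\hat\varepsilon^B_1$ with $\hat\varepsilon_i^B=\Phi\Big((-1)^i\frac{-(\mathbf m_i^*-\frac{\bar{\mathbf x}_0+\bar{\mathbf x}_1}{2})^T\Sigma^{-1}(\bar{\mathbf x}_0-\bar{\mathbf x}_1)+c}{\hat\delta}\sqrt{\frac{\nu_i^*}{\nu_i^*+1}}\Big)$, where $\mathbf m_i^*=\frac{n_i\bar{\mathbf x}_i+\nu_i\mathbf m_i}{n_i+\nu_i}$ and $\nu_i^*=n_i+\nu_i$. Notation: $\Delta^2_{\mathbf m}=(\mathbf m_0-\mathbf m_1)^T\Sigma^{-1}(\mathbf m_0-\mathbf m_1)$, and $\bar\Delta^2_{\mathbf m}$ its limit as $p\to\infty$. Unconditional asymptotic regime. Expectations $E_{\boldsymbol\mu,S_n}$ are over both $\boldsymbol\mu$ and the sample. As $p\to\infty$: $n_0,n_1,\nu_0,\nu_1\to\infty$, $p/n_i\to J_i\in[0,\infty)$, $\nu_i/n_i\to\gamma_i\in(0,\infty)$, and for all $i,j\in\{0,1\}$, $\mathbf m_i^T\Sigma^{-1}\mathbf m_j$ converges to a finite limit. It is assumed that $F>0$ (with $F$ as in the claim). $\lim_{p\to\infty}$ denotes the limit along this regime. *)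

theory Defs
  imports "HOL-Probability.Probability" "Jordan_Normal_Form.Gauss_Jordan_Elimination"
    "Jordan_Normal_Form.Determinant"
begin

definition Phi :: "real \<Rightarrow> real" where
  "Phi x = measure (density lborel std_normal_density) {..x}"

definition inv_mat :: "real mat \<Rightarrow> real mat" where
  "inv_mat A = the (mat_inverse A)"

definition spd_mat :: "nat \<Rightarrow> real mat \<Rightarrow> bool" where
  "spd_mat p A \<longleftrightarrow> A \<in> carrier_mat p p \<and> transpose_mat A = A \<and>
     (\<forall>v \<in> carrier_vec p. v \<noteq> 0\<^sub>v p \<longrightarrow> scalar_prod v (A *\<^sub>v v) > 0)"

definition qform :: "real mat \<Rightarrow> real vec \<Rightarrow> real vec \<Rightarrow> real" where
  "qform A u v = scalar_prod u (inv_mat A *\<^sub>v v)"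

(* density of N(m, C) on R^p, vectors represented as nat => real on {..<p} *)
definition mvn_density :: "nat \<Rightarrow> real vec \<Rightarrow> real mat \<Rightarrow> (nat \<Rightarrow> real) \<Rightarrow> real" where
  "mvn_density p m C x =
     (2 * pi) powr (- real p / 2) * det C powr (- 1 / 2) *
     exp (- (1 / 2) * qform C (vec p x - m) (vec p x - m))"

definition mvn :: "nat \<Rightarrow> real vec \<Rightarrow> real mat \<Rightarrow> (nat \<Rightarrow> real) measure" where
  "mvn p m C = density (PiM {..<p} (\<lambda>_. lborel)) (\<lambda>x. ennreal (mvn_density p m C x))"

definition iid_sample :: "nat \<Rightarrow> nat \<Rightarrow> (nat \<Rightarrow> real) \<Rightarrow> real mat \<Rightarrow> (nat \<Rightarrow> nat \<Rightarrow> real) measure" where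
  "iid_sample p n mu Sig = PiM {..<n} (\<lambda>_. mvn p (vec p mu) Sig)"

definition sample_mean :: "nat \<Rightarrow> nat \<Rightarrow> (nat \<Rightarrow> nat \<Rightarrow> real) \<Rightarrow> real vec" where
  "sample_mean p n S = vec p (\<lambda>k. (\<Sum>j<n. S j k) / real n)"

(* E_{mu,S_n}[ f(xbar0, xbar1) ]: mu_i ~ N(m_i, Sig/nu_i) independent; given mu,
   n0 iid points from N(mu0,Sig) and independently n1 iid points from N(mu1,Sig) *)
definition model_expect ::
  "nat \<Rightarrow> real mat \<Rightarrow> nat \<Rightarrow> nat \<Rightarrow> real \<Rightarrow> real \<Rightarrow> real vec \<Rightarrow> real vec \<Rightarrow>
   (real vec \<Rightarrow> real vec \<Rightarrow> real) \<Rightarrow> real" where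
  "model_expect p Sig n0 n1 nu0 nu1 m0 m1 f =
     (\<integral>mu0. (\<integral>mu1. (\<integral>S0. (\<integral>S1. f (sample_mean p n0 S0) (sample_mean p n1 S1)
        \<partial>iid_sample p n1 mu1 Sig) \<partial>iid_sample p n0 mu0 Sig)
        \<partial>mvn p m1 ((1 / nu1) \<cdot>\<^sub>m Sig)) \<partial>mvn p m0 ((1 / nu0) \<cdot>\<^sub>m Sig))"

(* Bayesian MMSE error estimator of class i (i = 0 or 1) for LDA with known Sigma *)
definition bayes_err_class ::
  "nat \<Rightarrow> real mat \<Rightarrow> nat \<Rightarrow> nat \<Rightarrow> real \<Rightarrow> real \<Rightarrow> real vec \<Rightarrow> real vec \<Rightarrow> real \<Rightarrow>
   real vec \<Rightarrow> real vec \<Rightarrow> real" where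
  "bayes_err_class i Sig n0 n1 nu0 nu1 m0 m1 c x0 x1 =
     (let n = real (if i = 0 then n0 else n1);
          nu = (if i = 0 then nu0 else nu1);
          m = (if i = 0 then m0 else m1);
          xi = (if i = 0 then x0 else x1);
          d = x0 - x1;
          mid = (1 / 2) \<cdot>\<^sub>v (x0 + x1);
          mstar = (1 / (n + nu)) \<cdot>\<^sub>v (n \<cdot>\<^sub>v xi + nu \<cdot>\<^sub>v m);
          nustar = n + nu;
          dhat = sqrt (qform Sig d d)
      in Phi ((-1) ^ i * ((- qform Sig (mstar - mid) d + c) / dhat) * sqrt (nustar / (nustar + 1))))"

definition bayes_err ::
  "real \<Rightarrow> real mat \<Rightarrow> nat \<Rightarrow> nat \<Rightarrow> real \<Rightarrow> real \<Rightarrow> real vec \<Rightarrow> real vec \<Rightarrow> real \<Rightarrow>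
   real vec \<Rightarrow> real vec \<Rightarrow> real" where
  "bayes_err a0 Sig n0 n1 nu0 nu1 m0 m1 c x0 x1 =
     a0 * bayes_err_class 0 Sig n0 n1 nu0 nu1 m0 m1 c x0 x1 +
     (1 - a0) * bayes_err_class 1 Sig n0 n1 nu0 nu1 m0 m1 c x0 x1"

end

theory Submission
  imports Defs
begin

text \<open>Write \<open>\<Sigma> = L L\<^sup>T\<close> with \<open>L\<close> lower triangular. The unconditional law of the sample
mean of class \<open>i\<close> is that of \<open>m\<^sub>i + L y\<^sub>i\<close>, where \<open>y\<^sub>0\<close>, \<open>y\<^sub>1\<close> are independent and have i.i.d.
\<open>N(0, 1 / \<nu>\<^sub>i + 1 / n\<^sub>i)\<close> coordinates. In whitened coordinates, with \<open>w = L\<inverse> (m\<^sub>0 - m\<^sub>1)\<close>, the error estimator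
is a continuous function of \<open>w \<bullet> w\<close>, \<open>n\<^sub>i / (n\<^sub>i + \<nu>\<^sub>i)\<close>, \<open>n\<^sub>i + \<nu>\<^sub>i\<close> and the five statistics
\<open>y\<^sub>i \<bullet> y\<^sub>i\<close>, \<open>w \<bullet> y\<^sub>i\<close> and \<open>y\<^sub>0 \<bullet> y\<^sub>1\<close>. These statistics converge in mean square to \<open>J\<^sub>i + J\<^sub>i / \<gamma>\<^sub>i\<close>, \<open>0\<close> and
\<open>0\<close>, and the estimator takes values in \<open>[0, 1]\<close>, so its expectation converges.\<close>

section \<open>Products of centred normal distributions\<close>

text \<open>The random class means are integrated out exactly: prior variance \<open>1 / nu\<close>
  and sampling variance \<open>1 / n\<close> add up, so nothing conditional on the means survives
  into the limit. A triangular root of the covariance is convenient because a triangular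
  substitution acts on Lebesgue measure one coordinate at a time; the density formula for N(m, C)
  then needs only one-dimensional substitutions and induction on the dimension. Laws are compared
  through nonnegative integrals, where Fubini asks for measurability only; the nested Bochner
  integrals of the model are converted level by level, using that the integrand lies in [0, 1].

  Concentration holds because \<open>p * (1 / nu + 1 / n)\<close> stays bounded while
  \<open>1 / nu + 1 / n\<close> vanishes: every variance that occurs is a bounded quantity times a
  vanishing one. The probability space changes with \<open>p\<close>, so the statistics cannot
  converge on a common space. The limit is instead taken along a filter on pairs of a dimension and
  a point of the corresponding space. The condition F > 0 keeps the denominator of the estimator
  away from zero in the limit, so that continuity suffices.\<close>

abbreviation Bvec :: "nat \<Rightarrow> (nat \<Rightarrow> real) measure" where
  "Bvec p \<equiv> PiM {..<p} (\<lambda>_. borel)"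

abbreviation gauss1 :: "real \<Rightarrow> real measure" where
  "gauss1 s \<equiv> density lborel (\<lambda>x. ennreal (normal_density 0 s x))"

definition gauss :: "nat \<Rightarrow> real \<Rightarrow> (nat \<Rightarrow> real) measure" where
  "gauss p s = PiM {..<p} (\<lambda>_. gauss1 s)"

lemma sets_gauss [measurable_cong, simp]: "sets (gauss p s) = sets (Bvec p)"
  unfolding gauss_def by (intro sets_PiM_cong) auto

lemma space_gauss [simp]: "space (gauss p s) = space (Bvec p)"
  by (rule sets_eq_imp_space_eq) simp

lemma product_prob_space_gauss1:
  "0 < s \<Longrightarrow> product_prob_space (\<lambda>_. gauss1 s)"
  using prob_space_normal_density[of s 0]
  by (intro product_prob_spaceI) auto

lemma prob_space_gauss: "0 < s \<Longrightarrow> prob_space (gauss p s)"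
  unfolding gauss_def
  by (intro prob_space_PiM prob_space_normal_density) auto

lemma nn_integral_gauss1_scale:
  assumes "0 < s" "0 < a" and f [measurable]: "f \<in> borel_measurable borel"
  shows "(\<integral>\<^sup>+x. f (a * x) \<partial>gauss1 s) = (\<integral>\<^sup>+x. f x \<partial>gauss1 (a * s))"
proof -
  have eq: "a * normal_density 0 (a * s) (a * x) = normal_density 0 s x" for x
    using assms by (simp add: normal_density_def power_mult_distrib real_sqrt_mult)
  have "(\<integral>\<^sup>+x. f x \<partial>gauss1 (a * s)) = (\<integral>\<^sup>+x. ennreal (normal_density 0 (a * s) x) * f x \<partial>lborel)"
    by (simp add: nn_integral_density)
  also have "\<dots> = ennreal \<bar>a\<bar> * (\<integral>\<^sup>+x. ennreal (normal_density 0 (a * s) (0 + a * x)) * f (0 + a * x) \<partial>lborel)"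
    using assms by (intro nn_integral_real_affine) auto
  also have "\<dots> = (\<integral>\<^sup>+x. ennreal (normal_density 0 s x) * f (a * x) \<partial>lborel)"
    using assms
    by (subst nn_integral_cmult[symmetric])
       (auto simp: mult.assoc[symmetric] ennreal_mult[symmetric] eq)
  finally show ?thesis by (simp add: nn_integral_density)
qed

text \<open>Rescaling both variables reduces to coefficients 1, where the convolution of centred
  normal densities applies. Laws of linear combinations are stated as integral identities rather
  than push-forwards so that they can be rewritten inside nested integrals.\<close>

lemma nn_integral_gauss1_conv:
  assumes "0 < s" "0 < t" "0 < a" "0 < b" and f [measurable]: "f \<in> borel_measurable borel"
  shows "(\<integral>\<^sup>+x. \<integral>\<^sup>+y. f (a * x + b * y) \<partial>gauss1 t \<partial>gauss1 s)
       = (\<integral>\<^sup>+x. f x \<partial>gauss1 (sqrt (a\<^sup>2 * s\<^sup>2 + b\<^sup>2 * t\<^sup>2)))"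
proof -
  interpret S: prob_space "gauss1 (a * s)" using assms by (intro prob_space_normal_density) auto
  interpret T: prob_space "gauss1 (b * t)" using assms by (intro prob_space_normal_density) auto
  have "(\<integral>\<^sup>+x. \<integral>\<^sup>+y. f (a * x + b * y) \<partial>gauss1 t \<partial>gauss1 s)
      = (\<integral>\<^sup>+x. (\<lambda>u. \<integral>\<^sup>+y. f (u + y) \<partial>gauss1 (b * t)) (a * x) \<partial>gauss1 s)"
    using assms by (intro nn_integral_cong nn_integral_gauss1_scale[where f="\<lambda>v. f (_ + v)"]) auto
  also have "\<dots> = (\<integral>\<^sup>+x. \<integral>\<^sup>+y. f (x + y) \<partial>gauss1 (b * t) \<partial>gauss1 (a * s))"
    using assms by (intro nn_integral_gauss1_scale) auto
  also have "\<dots> = (\<integral>\<^sup>+x. f x \<partial>(gauss1 (a * s) \<star> gauss1 (b * t)))"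
    by (rule nn_integral_convolution[symmetric]) (auto intro: S.finite_measure_axioms T.finite_measure_axioms)
  also have "gauss1 (a * s) \<star> gauss1 (b * t)
      = gauss1 (sqrt ((a * s)\<^sup>2 + (b * t)\<^sup>2))"
    using conv_normal_density_zero_mean[of "a * s" "b * t"] assms S.finite_measure_axioms T.finite_measure_axioms
    by (subst convolution_density) (auto simp: ennreal_mult'[symmetric])
  finally show ?thesis by (simp add: power_mult_distrib)
qed

lemma measurable_gauss1_PiM:
  "f \<in> borel_measurable (Bvec p) \<Longrightarrow> f \<in> borel_measurable (PiM {..<p} (\<lambda>_. gauss1 s))"
  by (simp cong: measurable_cong_sets sets_PiM_cong)

text \<open>Splitting off the last coordinate drives the inductions on the dimension; the order of
  integration is the one that leaves a one-dimensional problem inside.\<close>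

lemma nn_integral_gauss_Suc:
  assumes s: "0 < s" and f [measurable]: "f \<in> borel_measurable (Bvec (Suc p))"
  shows "(\<integral>\<^sup>+x. f x \<partial>gauss (Suc p) s) = (\<integral>\<^sup>+x. \<integral>\<^sup>+t. f (x(p := t)) \<partial>gauss1 s \<partial>gauss p s)"
proof -
  interpret product_prob_space "\<lambda>_::nat. gauss1 s" by (rule product_prob_space_gauss1[OF s])
  have "f \<in> borel_measurable (PiM (insert p {..<p}) (\<lambda>_. gauss1 s))"
    using measurable_gauss1_PiM[OF f] by (simp add: lessThan_Suc)
  from product_nn_integral_insert[OF _ _ this]
  show ?thesis by (simp add: gauss_def lessThan_Suc)
qed

lemma measurable_upd_Bvec [measurable]:
  assumes [measurable]: "g \<in> measurable M (Bvec p)" "h \<in> borel_measurable M"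
  shows "(\<lambda>x. (g x)(p := h x)) \<in> measurable M (Bvec (Suc p))"
  by (rule measurable_fun_upd[where J="{..<p}"]) (auto simp: lessThan_Suc)

lemma measurable_Bvec_component [measurable]:
  "k < p \<Longrightarrow> (\<lambda>x. x k) \<in> borel_measurable (Bvec p)"
  by measurable

text \<open>Coordinates are independent, so the one-dimensional convolution applies to each of them.
  The restriction to \<open>{..<p}\<close> keeps the combined vector in the extensional function
  space of the product measure.\<close>

lemma nn_integral_gauss_conv:
  assumes "0 < s" "0 < t" "0 < a" "0 < b" and "f \<in> borel_measurable (Bvec p)"
  shows "(\<integral>\<^sup>+x. \<integral>\<^sup>+y. f (\<lambda>k\<in>{..<p}. a * x k + b * y k) \<partial>gauss p t \<partial>gauss p s)
       = (\<integral>\<^sup>+x. f x \<partial>gauss p (sqrt (a\<^sup>2 * s\<^sup>2 + b\<^sup>2 * t\<^sup>2)))"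
  using assms(5)
proof (induction p arbitrary: f)
  case 0
  then show ?case
    by (simp add: gauss_def PiM_empty nn_integral_count_space_finite)
next
  case (Suc p)
  note [measurable] = Suc.prems
  interpret GTS: prob_space "gauss (Suc p) t" by (rule prob_space_gauss) fact
  let ?r = "sqrt (a\<^sup>2 * s\<^sup>2 + b\<^sup>2 * t\<^sup>2)"
  have r: "0 < ?r" using assms by (simp add: add_pos_pos)
  interpret GT: prob_space "gauss p t" by (rule prob_space_gauss) fact
  interpret NT: prob_space "gauss1 t" by (intro prob_space_normal_density) fact
  interpret NS: prob_space "gauss1 s" by (intro prob_space_normal_density) fact
  interpret NR: prob_space "gauss1 ?r" using r by (intro prob_space_normal_density)
  interpret P: pair_sigma_finite "gauss p t" "gauss1 s" ..
  define add where "add q x y = (\<lambda>k\<in>{..<q}. a * x k + b * y k)" for q :: nat and x y :: "nat \<Rightarrow> real"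
  have add_m [measurable]: "(\<lambda>z. add q (g z) (h z)) \<in> measurable M (Bvec q)"
    if [measurable]: "g \<in> measurable M (Bvec q)" "h \<in> measurable M (Bvec q)" for q g h and M :: "'z measure"
    unfolding add_def by (rule measurable_restrict) (auto intro!: measurable_compose[OF that(1)] measurable_compose[OF that(2)])
  have upd: "add (Suc p) (x(p := u)) (y(p := v)) = (add p x y)(p := a * u + b * v)" for x y u v
    by (auto simp: add_def fun_eq_iff)
  have "(\<integral>\<^sup>+x. \<integral>\<^sup>+y. f (add (Suc p) x y) \<partial>gauss (Suc p) t \<partial>gauss (Suc p) s)
     = (\<integral>\<^sup>+x. \<integral>\<^sup>+u. \<integral>\<^sup>+y. f (add (Suc p) (x(p:=u)) y) \<partial>gauss (Suc p) t \<partial>gauss1 s \<partial>gauss p s)"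
    by (rule nn_integral_gauss_Suc[OF assms(1)]) measurable
  also have "\<dots> = (\<integral>\<^sup>+x. \<integral>\<^sup>+u. \<integral>\<^sup>+y. \<integral>\<^sup>+v. f ((add p x y)(p:= a * u + b * v)) \<partial>gauss1 t \<partial>gauss p t \<partial>gauss1 s \<partial>gauss p s)"
    by (intro nn_integral_cong, subst nn_integral_gauss_Suc[OF assms(2)])
       (auto simp: upd intro!: measurable_compose[OF _ Suc.prems] add_m)
  \<comment> \<open>Exchanging \<open>u\<close> with the first \<open>p\<close> coordinates of the
    second vector makes the two last coordinates neighbours.\<close>
  also have "\<dots> = (\<integral>\<^sup>+x. \<integral>\<^sup>+y. \<integral>\<^sup>+u. \<integral>\<^sup>+v. f ((add p x y)(p:= a * u + b * v)) \<partial>gauss1 t \<partial>gauss1 s \<partial>gauss p t \<partial>gauss p s)"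
    by (intro nn_integral_cong P.Fubini') (simp, measurable)
  also have "\<dots> = (\<integral>\<^sup>+x. \<integral>\<^sup>+y. \<integral>\<^sup>+u. f ((add p x y)(p:= u)) \<partial>gauss1 ?r \<partial>gauss p t \<partial>gauss p s)"
    using assms
    by (intro nn_integral_cong nn_integral_gauss1_conv[where f="\<lambda>u. f (_(p:=u))"]) auto
  also have "\<dots> = (\<integral>\<^sup>+x. \<integral>\<^sup>+u. f (x(p:= u)) \<partial>gauss1 ?r \<partial>gauss p ?r)"
    unfolding add_def
    by (rule Suc.IH) measurable
  also have "\<dots> = (\<integral>\<^sup>+x. f x \<partial>gauss (Suc p) ?r)"
    by (rule nn_integral_gauss_Suc[OF r, symmetric]) measurable
  finally show ?case unfolding add_def .
qed

section \<open>Cholesky factors and triangular changes of variables\<close>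

text \<open>Induction on \<open>n\<close> by eliminating the first row and column: a factor of the
  Schur complement is bordered by the first column divided by the root of the corner entry. Index
  functions replace matrices so that removing a row is a shift by \<open>Suc\<close>.\<close>

lemma cholesky:
  fixes A :: "nat \<Rightarrow> nat \<Rightarrow> real"
  assumes "\<And>i j. i < n \<Longrightarrow> j < n \<Longrightarrow> A i j = A j i"
    and "\<And>v. \<exists>i<n. v i \<noteq> 0 \<Longrightarrow> 0 < (\<Sum>i<n. \<Sum>j<n. v i * A i j * v j)"
  obtains L where "\<And>i j. i < j \<Longrightarrow> L i j = 0" "\<And>i. i < n \<Longrightarrow> 0 < L i i"
    "\<And>i j. i < n \<Longrightarrow> j < n \<Longrightarrow> A i j = (\<Sum>k<n. L i k * L j k)"
proof -
  have "\<exists>L. (\<forall>i j. i < j \<longrightarrow> L i j = 0) \<and> (\<forall>i<n. 0 < L i i) \<and>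
      (\<forall>i<n. \<forall>j<n. A i j = (\<Sum>k<n. L i k * L j k))"
    using assms
  proof (induction n arbitrary: A)
    case 0
    show ?case by (rule exI[of _ "\<lambda>_ _. 0"]) simp
  next
    case (Suc n)
    note sym = Suc.prems(1) and pd = Suc.prems(2)
    define a where "a = A 0 0"
    have a: "0 < a"
      using pd[of "\<lambda>i. if i = 0 then 1 else 0"]
      by (simp add: a_def sum.lessThan_Suc_shift del: sum.lessThan_Suc)
    \<comment> \<open>The Schur complement of the corner entry.\<close>
    define A' where "A' i j = A (Suc i) (Suc j) - A (Suc i) 0 * A (Suc j) 0 / a" for i j
    have "\<exists>L. (\<forall>i j. i < j \<longrightarrow> L i j = 0) \<and> (\<forall>i<n. 0 < L i i) \<and>
      (\<forall>i<n. \<forall>j<n. A' i j = (\<Sum>k<n. L i k * L j k))"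
    proof (rule Suc.IH)
      fix i j assume "i < n" "j < n"
      then show "A' i j = A' j i" using sym[of "Suc i" "Suc j"] by (simp add: A'_def mult.commute)
    next
      fix v :: "nat \<Rightarrow> real" assume v: "\<exists>i<n. v i \<noteq> 0"
      define s where "s = (\<Sum>i<n. A (Suc i) 0 * v i)"
      \<comment> \<open>The first entry minimises the quadratic form of \<open>A\<close> when the
        others are fixed to \<open>v\<close>; at this minimum the form equals that of the Schur
        complement at \<open>v\<close>.\<close>
      define u where "u = case_nat (- s / a) v"
      have "\<exists>i<Suc n. u i \<noteq> 0"
      proof -
        from v obtain i where "i < n" "v i \<noteq> 0" by blast
        then show ?thesis by (intro exI[of _ "Suc i"]) (simp add: u_def)
      qed
      from pd[OF this]
      have "0 < (\<Sum>i<Suc n. \<Sum>j<Suc n. u i * A i j * u j)" .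
      also have "\<dots> = (s / a) * (s / a) * a - 2 * (s / a) * s
          + (\<Sum>i<n. \<Sum>j<n. v i * A (Suc i) (Suc j) * v j)"
      proof -
        have "(\<Sum>j<n. A 0 (Suc j) * v j) = s"
          unfolding s_def using sym by (intro sum.cong) auto
        then have "(\<Sum>j<n. s * A 0 (Suc j) * v j / a) = s * s / a"
          by (simp add: sum_distrib_left[symmetric] sum_divide_distrib[symmetric] mult.assoc)
        moreover have "(\<Sum>i<n. v i * A (Suc i) 0 * s / a) = s * s / a"
          by (simp add: s_def sum_distrib_right sum_divide_distrib mult_ac)
        ultimately show ?thesis
          by (simp add: u_def a_def[symmetric] sum.lessThan_Suc_shift sum.distrib sum_negf sum_subtractf del: sum.lessThan_Suc)
      qed
      also have "\<dots> = (\<Sum>i<n. \<Sum>j<n. v i * A (Suc i) (Suc j) * v j) - s * s / a"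
        using a by (simp add: field_simps)
      also have "s * s / a = (\<Sum>i<n. \<Sum>j<n. v i * (A (Suc i) 0 * A (Suc j) 0 / a) * v j)"
        by (simp add: s_def sum_product sum_divide_distrib mult_ac)
      finally show "0 < (\<Sum>i<n. \<Sum>j<n. v i * A' i j * v j)"
        by (simp add: A'_def algebra_simps sum_subtractf)
    qed
    then obtain L where L: "\<And>i j. i < j \<Longrightarrow> L i j = 0" "\<And>i. i < n \<Longrightarrow> 0 < L i i"
      "\<And>i j. i < n \<Longrightarrow> j < n \<Longrightarrow> A' i j = (\<Sum>k<n. L i k * L j k)" by blast
    define L' where "L' i j = (case i of 0 \<Rightarrow> if j = 0 then sqrt a else 0
      | Suc i \<Rightarrow> (case j of 0 \<Rightarrow> A (Suc i) 0 / sqrt a | Suc j \<Rightarrow> L i j))" for i j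
    have sq: "x * y / (sqrt a * sqrt a) = x * y / a" for x y using a by simp
    show ?case
    proof (intro exI[of _ L'] conjI allI impI)
      fix i j :: nat assume "i < j" then show "L' i j = 0"
        using L(1) by (auto simp: L'_def split: nat.split)
    next
      fix i assume "i < Suc n" then show "0 < L' i i"
        using L(2) a by (auto simp: L'_def split: nat.split)
    next
      fix i j assume ij: "i < Suc n" "j < Suc n"
      show "A i j = (\<Sum>k<Suc n. L' i k * L' j k)"
        using ij a L(3)[of "i - 1" "j - 1"] sym[of 0 j]
        by (cases i; cases j)
           (auto simp: L'_def A'_def a_def[symmetric] sq sum.lessThan_Suc_shift simp del: sum.lessThan_Suc)
    qed
  qed
  with that show ?thesis by blast
qed

section \<open>Lebesgue measure under triangular affine substitutions\<close>

abbreviation Lvec :: "nat \<Rightarrow> (nat \<Rightarrow> real) measure" where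
  "Lvec p \<equiv> PiM {..<p} (\<lambda>_. lborel)"

lemma sets_Lvec [measurable_cong]: "sets (Lvec p) = sets (Bvec p)"
  by (intro sets_PiM_cong) auto

lemma nn_integral_Lvec_Suc:
  assumes f [measurable]: "f \<in> borel_measurable (Bvec (Suc p))"
  shows "(\<integral>\<^sup>+x. f x \<partial>Lvec (Suc p)) = (\<integral>\<^sup>+x. \<integral>\<^sup>+t. f (x(p := t)) \<partial>lborel \<partial>Lvec p)"
proof -
  interpret product_sigma_finite "\<lambda>_::nat. lborel :: real measure" ..
  have "f \<in> borel_measurable (PiM (insert p {..<p}) (\<lambda>_. lborel))"
    using f by (simp add: lessThan_Suc sets_Lvec cong: measurable_cong_sets sets_PiM_cong)
  from product_nn_integral_insert[OF _ _ this]
  show ?thesis by (simp add: lessThan_Suc)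
qed

text \<open>Bridges two encodings: \<open>gauss\<close> is a product of measures with densities,
  whereas \<open>mvn\<close> is one density with respect to a product of Lebesgue measures.\<close>

lemma nn_integral_gauss_density:
  assumes s: "0 < s" and "f \<in> borel_measurable (Bvec p)"
  shows "(\<integral>\<^sup>+x. f x \<partial>gauss p s) = (\<integral>\<^sup>+x. ennreal (\<Prod>k<p. normal_density 0 s (x k)) * f x \<partial>Lvec p)"
  using assms(2)
proof (induction p arbitrary: f)
  case 0
  then show ?case
    by (simp add: gauss_def PiM_empty nn_integral_count_space_finite)
next
  case (Suc p)
  note [measurable] = Suc.prems
  interpret NS: prob_space "gauss1 s" by (intro prob_space_normal_density) fact
  let ?d = "\<lambda>x. \<Prod>k<p. normal_density 0 s (x k)"
  have "(\<integral>\<^sup>+x. f x \<partial>gauss (Suc p) s) = (\<integral>\<^sup>+x. \<integral>\<^sup>+t. f (x(p := t)) \<partial>gauss1 s \<partial>gauss p s)"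
    by (rule nn_integral_gauss_Suc[OF s]) measurable
  also have "\<dots> = (\<integral>\<^sup>+x. ennreal (?d x) * (\<integral>\<^sup>+t. f (x(p := t)) \<partial>gauss1 s) \<partial>Lvec p)"
    by (rule Suc.IH) measurable
  also have "\<dots> = (\<integral>\<^sup>+x. \<integral>\<^sup>+t. ennreal (\<Prod>k<Suc p. normal_density 0 s ((x(p := t)) k)) * f (x(p := t)) \<partial>lborel \<partial>Lvec p)"
  proof (intro nn_integral_cong)
    fix x :: "nat \<Rightarrow> real" assume "x \<in> space (Lvec p)"
    then have [measurable, simp]: "x \<in> space (Bvec p)" by (simp add: space_PiM)
    have p: "(\<Prod>k<p. normal_density 0 s (if k = p then t else x k)) = ?d x" for t
      by (intro prod.cong) auto
    show "ennreal (?d x) * (\<integral>\<^sup>+t. f (x(p := t)) \<partial>gauss1 s)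
      = (\<integral>\<^sup>+t. ennreal (\<Prod>k<Suc p. normal_density 0 s ((x(p := t)) k)) * f (x(p := t)) \<partial>lborel)"
      by (subst nn_integral_density)
         (auto simp: nn_integral_cmult[symmetric] p ennreal_mult prod_nonneg mult.assoc)
  qed
  also have "\<dots> = (\<integral>\<^sup>+x. ennreal (\<Prod>k<Suc p. normal_density 0 s (x k)) * f x \<partial>Lvec (Suc p))"
    by (rule nn_integral_Lvec_Suc[symmetric]) measurable
  finally show ?case .
qed

definition aff :: "nat \<Rightarrow> (nat \<Rightarrow> real) \<Rightarrow> (nat \<Rightarrow> nat \<Rightarrow> real) \<Rightarrow> (nat \<Rightarrow> real) \<Rightarrow> nat \<Rightarrow> real" where
  "aff p b L z = (\<lambda>k\<in>{..<p}. b k + (\<Sum>l<p. L k l * z l))"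

lemma measurable_aff [measurable]:
  assumes [measurable]: "\<And>k. k < p \<Longrightarrow> (\<lambda>x. b x k) \<in> borel_measurable M"
    and [measurable]: "g \<in> measurable M (Bvec p)"
  shows "(\<lambda>x. aff p (b x) L (g x)) \<in> measurable M (Bvec p)"
  unfolding aff_def
  by (intro measurable_restrict borel_measurable_add borel_measurable_sum borel_measurable_times) auto

text \<open>The last image coordinate is \<open>L p p * t\<close> plus a shift by earlier
  coordinates, and the earlier image coordinates ignore \<open>t\<close>. Each inductive step is
  therefore a one-dimensional affine substitution, contributing one diagonal entry to the Jacobian.
  Since \<open>L\<close> is a function on all indices, the same \<open>L\<close> serves every
  dimension of the induction.\<close>

lemma nn_integral_Lvec_triangular:
  assumes "f \<in> borel_measurable (Bvec p)"
    and low: "\<And>i j. i < j \<Longrightarrow> L i j = 0" and "\<And>i. i < p \<Longrightarrow> 0 < L i i"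
  shows "(\<integral>\<^sup>+x. f x \<partial>Lvec p) = ennreal (\<Prod>k<p. L k k) * (\<integral>\<^sup>+z. f (aff p b L z) \<partial>Lvec p)"
  using assms(1,3)
proof (induction p arbitrary: f)
  case 0
  then show ?case
    by (simp add: aff_def PiM_empty nn_integral_count_space_finite)
next
  case (Suc p)
  note [measurable] = Suc.prems(1)
  let ?P = "ennreal (\<Prod>k<p. L k k)"
  define c where "c z = b p + (\<Sum>l<p. L p l * z l)" for z
  have [measurable]: "c \<in> borel_measurable (Bvec p)" unfolding c_def by measurable
  have upd: "aff (Suc p) b L (z(p := t)) = (aff p b L z)(p := c z + L p p * t)" for z t
    using low by (auto simp: aff_def c_def fun_eq_iff intro!: sum.cong)
  have "(\<integral>\<^sup>+x. f x \<partial>Lvec (Suc p)) = (\<integral>\<^sup>+x. \<integral>\<^sup>+t. f (x(p := t)) \<partial>lborel \<partial>Lvec p)"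
    by (rule nn_integral_Lvec_Suc) measurable
  also have "\<dots> = ?P * (\<integral>\<^sup>+z. \<integral>\<^sup>+t. f ((aff p b L z)(p := t)) \<partial>lborel \<partial>Lvec p)"
  proof (rule Suc.IH)
    show "(\<lambda>x. \<integral>\<^sup>+t. f (x(p := t)) \<partial>lborel) \<in> borel_measurable (Bvec p)" by measurable
  qed (use Suc.prems(2) in auto)
  also have "\<dots> = ?P * (\<integral>\<^sup>+z. ennreal (L p p) * (\<integral>\<^sup>+t. f ((aff p b L z)(p := c z + L p p * t)) \<partial>lborel) \<partial>Lvec p)"
  proof (intro arg_cong[where f="(*) _"] nn_integral_cong)
    fix z :: "nat \<Rightarrow> real" assume "z \<in> space (Lvec p)"
    then have [measurable, simp]: "z \<in> space (Bvec p)" by (simp add: space_PiM)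
    show "(\<integral>\<^sup>+t. f ((aff p b L z)(p := t)) \<partial>lborel) =
      ennreal (L p p) * (\<integral>\<^sup>+t. f ((aff p b L z)(p := c z + L p p * t)) \<partial>lborel)"
      using Suc.prems(2)[of p]
      by (subst nn_integral_real_affine[where c="L p p" and t="c z"]) auto
  qed
  also have "\<dots> = ?P * ennreal (L p p) * (\<integral>\<^sup>+z. \<integral>\<^sup>+t. f (aff (Suc p) b L (z(p := t))) \<partial>lborel \<partial>Lvec p)"
    by (subst nn_integral_cmult) (auto simp: upd mult.assoc)
  also have "?P * ennreal (L p p) = ennreal (\<Prod>k<Suc p. L k k)"
    using Suc.prems(2)[of p] by (simp add: ennreal_mult'')
  also have "(\<integral>\<^sup>+z. \<integral>\<^sup>+t. f (aff (Suc p) b L (z(p := t))) \<partial>lborel \<partial>Lvec p) = (\<integral>\<^sup>+z. f (aff (Suc p) b L z) \<partial>Lvec (Suc p))"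
    by (rule nn_integral_Lvec_Suc[symmetric]) measurable
  finally show ?case .
qed

section \<open>Triangular factors of covariance matrices and whitening\<close>

definition tri_factor :: "nat \<Rightarrow> real mat \<Rightarrow> (nat \<Rightarrow> nat \<Rightarrow> real) \<Rightarrow> bool" where
  "tri_factor p C L \<longleftrightarrow> C \<in> carrier_mat p p \<and> (\<forall>i j. i < j \<longrightarrow> L i j = 0) \<and> (\<forall>i<p. 0 < L i i) \<and>
    (\<forall>i<p. \<forall>j<p. C $$ (i, j) = (\<Sum>k<p. L i k * L j k))"

lemma spd_tri_factor:
  assumes "spd_mat p C"
  obtains L where "tri_factor p C L"
proof -
  have C: "C \<in> carrier_mat p p" and tr: "transpose_mat C = C"
    and pd: "\<And>v. v \<in> carrier_vec p \<Longrightarrow> v \<noteq> 0\<^sub>v p \<Longrightarrow> 0 < scalar_prod v (C *\<^sub>v v)"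
    using assms by (auto simp: spd_mat_def)
  have sym: "C $$ (i, j) = C $$ (j, i)" if "i < p" "j < p" for i j
    using C that by (subst tr[symmetric]) simp
  have pd': "0 < (\<Sum>i<p. \<Sum>j<p. v i * C $$ (i, j) * v j)" if "\<exists>i<p. v i \<noteq> 0" for v
  proof -
    have "vec p v \<noteq> 0\<^sub>v p" using that by (auto simp: vec_eq_iff)
    with pd[of "vec p v"] have "0 < scalar_prod (vec p v) (C *\<^sub>v vec p v)" by simp
    also have "\<dots> = (\<Sum>i<p. \<Sum>j<p. v i * C $$ (i, j) * v j)"
      using C by (simp add: scalar_prod_def atLeast0LessThan sum_distrib_left mult.assoc)
    finally show ?thesis .
  qed
  obtain L where "\<And>i j. i < j \<Longrightarrow> L i j = 0" "\<And>i. i < p \<Longrightarrow> 0 < L i i"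
    "\<And>i j. i < p \<Longrightarrow> j < p \<Longrightarrow> C $$ (i, j) = (\<Sum>k<p. L i k * L j k)"
    using cholesky[of p "\<lambda>i j. C $$ (i, j)"] sym pd' by blast
  with C that show ?thesis by (auto simp: tri_factor_def)
qed

text \<open>Lets one factor of \<open>Sig\<close> serve the priors with covariance
  \<open>Sig / nu\<close> as well, so that means and samples share the same whitened
  coordinates.\<close>

lemma tri_factor_scale:
  assumes "tri_factor p C L" "0 < c"
  shows "tri_factor p (c \<cdot>\<^sub>m C) (\<lambda>i j. sqrt c * L i j)"
proof -
  have "(\<Sum>k<p. sqrt c * x k * (sqrt c * y k)) = c * (\<Sum>k<p. x k * y k)" for x y
  proof -
    have "sqrt c * a * (sqrt c * b) = c * (a * b)" for a b
      using assms(2) by (metis (no_types) less_imp_le mult.assoc mult.left_commute real_sqrt_mult_self abs_of_pos)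
    then show ?thesis unfolding sum_distrib_left by (intro sum.cong) auto
  qed
  with assms show ?thesis by (auto simp: tri_factor_def)
qed

text \<open>For \<open>K\<close> the inverse of the triangular matrix, the inverse of
  \<open>C\<close> is the transpose of \<open>K\<close> times \<open>K\<close>; this turns forms in
  the inverse covariance into plain scalar products. The determinant is recorded because its root
  cancels the Jacobian of the triangular substitution.\<close>

lemma tri_factor_whitening:
  assumes "tri_factor p C L"
  defines "Lm \<equiv> mat p p (\<lambda>(i, j). L i j)"
  obtains K where "K \<in> carrier_mat p p" "K * Lm = 1\<^sub>m p"
    "\<And>u v. u \<in> carrier_vec p \<Longrightarrow> v \<in> carrier_vec p \<Longrightarrow> qform C u v = scalar_prod (K *\<^sub>v u) (K *\<^sub>v v)"
    "det C = (\<Prod>k<p. L k k)\<^sup>2"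
proof -
  have C: "C \<in> carrier_mat p p" and low: "\<And>i j. i < j \<Longrightarrow> L i j = 0"
    and pos: "\<And>i. i < p \<Longrightarrow> 0 < L i i"
    and fac: "\<And>i j. i < p \<Longrightarrow> j < p \<Longrightarrow> C $$ (i, j) = (\<Sum>k<p. L i k * L j k)"
    using assms by (auto simp: tri_factor_def)
  have Lm: "Lm \<in> carrier_mat p p" by (simp add: Lm_def)
  have CL: "C = Lm * transpose_mat Lm"
    using C by (intro eq_matI) (auto simp: Lm_def fac scalar_prod_def atLeast0LessThan)
  have detL: "det Lm = (\<Prod>k<p. L k k)"
    using det_lower_triangular[OF _ Lm] low Lm
    by (simp add: Lm_def prod_list_diag_prod atLeast0LessThan)
  have "det Lm \<noteq> 0" unfolding detL using pos by (fastforce simp: prod_zero_iff)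
  then have "Lm \<in> Units (ring_mat TYPE(real) p undefined)"
    using Lm by (rule det_non_zero_imp_unit[rotated])
  then obtain K where K: "K \<in> carrier_mat p p" "K * Lm = 1\<^sub>m p" "Lm * K = 1\<^sub>m p"
    by (auto simp: Units_def ring_mat_def)
  let ?B = "transpose_mat K * K"
  have KT: "transpose_mat Lm * transpose_mat K = 1\<^sub>m p"
    using K Lm by (metis transpose_mult transpose_one)
  have B: "?B \<in> carrier_mat p p" using K by simp
  have CB: "C * ?B = 1\<^sub>m p"
  proof -
    have "C * ?B = Lm * (transpose_mat Lm * (transpose_mat K * K))"
      unfolding CL using Lm K by (intro assoc_mult_mat) auto
    also have "transpose_mat Lm * (transpose_mat K * K) = (transpose_mat Lm * transpose_mat K) * K"
      using Lm K by (intro assoc_mult_mat[symmetric]) auto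
    finally show ?thesis using K KT by simp
  qed
  have BC: "?B * C = 1\<^sub>m p"
    using mat_mult_left_right_inverse[OF C B CB] .
  \<comment> \<open>\<open>inv_mat\<close> applies \<open>the\<close> to an option, so existence of
    the inverse comes before its identification.\<close>
  have "mat_inverse C \<noteq> None"
    using mat_inverse(1)[OF C, of undefined] B C BC CB by (auto simp: Units_def ring_mat_def)
  then obtain D where D: "mat_inverse C = Some D" by auto
  from mat_inverse(2)[OF C D] have D': "C * D = 1\<^sub>m p" "D \<in> carrier_mat p p" by auto
  have "D = ?B"
  proof -
    have "D = (?B * C) * D" unfolding BC using D' by simp
    also have "\<dots> = ?B * (C * D)" using B C D' by (intro assoc_mult_mat) auto
    finally show ?thesis unfolding D'(1) using right_mult_one_mat[OF B] by simp
  qed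
  then have inv: "inv_mat C = ?B" by (simp add: inv_mat_def D)
  have q: "qform C u v = scalar_prod (K *\<^sub>v u) (K *\<^sub>v v)"
    if [simp]: "u \<in> carrier_vec p" "v \<in> carrier_vec p" for u v
  proof -
    have "qform C u v = scalar_prod u (transpose_mat K *\<^sub>v (K *\<^sub>v v))"
      using K by (simp add: qform_def inv assoc_mult_mat_vec[of _ p p _ p])
    also have "\<dots> = scalar_prod (K *\<^sub>v u) (K *\<^sub>v v)"
      using K comm_scalar_prod[of u p "transpose_mat K *\<^sub>v (K *\<^sub>v v)"]
        transpose_vec_mult_scalar[of K p p u "K *\<^sub>v v"] comm_scalar_prod[of "K *\<^sub>v v" p "K *\<^sub>v u"]
      by simp
    finally show ?thesis .
  qed
  have "det C = (\<Prod>k<p. L k k)\<^sup>2"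
    unfolding CL using det_mult[OF Lm] det_transpose[OF Lm] Lm by (simp add: detL power2_eq_square)
  with K q that show ?thesis by blast
qed

section \<open>Multivariate normal distributions\<close>

text \<open>Translates between the index-function form of the affine map, used for integration, and
  the matrix form, used for quadratic forms.\<close>

lemma tri_factor_mult_vec:
  assumes "K \<in> carrier_mat p p" "K * mat p p (\<lambda>(i, j). L i j) = 1\<^sub>m p" "m \<in> carrier_vec p"
  shows "vec p (aff p (\<lambda>k. vec_index m k) L z) = m + mat p p (\<lambda>(i, j). L i j) *\<^sub>v vec p z"
    and "K *\<^sub>v (mat p p (\<lambda>(i, j). L i j) *\<^sub>v vec p z) = vec p z"
proof -
  show "vec p (aff p (\<lambda>k. vec_index m k) L z) = m + mat p p (\<lambda>(i, j). L i j) *\<^sub>v vec p z"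
    using assms(3) by (intro eq_vecI) (auto simp: aff_def scalar_prod_def atLeast0LessThan)
  show "K *\<^sub>v (mat p p (\<lambda>(i, j). L i j) *\<^sub>v vec p z) = vec p z"
    using assms(1,2) by (subst assoc_mult_mat_vec[symmetric, of _ p p _ p]) auto
qed

text \<open>Measurability of a vector-valued map is expressed by its coordinates, so the scalar
  product is expanded into a finite sum of products of coordinates.\<close>

lemma measurable_mult_mat_vec:
  fixes K :: "real mat"
  assumes "K \<in> carrier_mat p p" and [measurable]: "\<And>k. k < p \<Longrightarrow> (\<lambda>x. vec_index (u x) k) \<in> borel_measurable M"
    "\<And>k. k < p \<Longrightarrow> (\<lambda>x. vec_index (v x) k) \<in> borel_measurable M"
    and "\<And>x. u x \<in> carrier_vec p" "\<And>x. v x \<in> carrier_vec p"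
  shows "(\<lambda>x. scalar_prod (K *\<^sub>v u x) (K *\<^sub>v v x)) \<in> borel_measurable M"
proof -
  have "scalar_prod (K *\<^sub>v u x) (K *\<^sub>v v x)
      = (\<Sum>i<p. (\<Sum>j<p. K $$ (i, j) * vec_index (u x) j) * (\<Sum>j<p. K $$ (i, j) * vec_index (v x) j))" for x
    using assms(1)
    by (auto simp: scalar_prod_def atLeast0LessThan carrier_vecD[OF assms(4)] carrier_vecD[OF assms(5)]
        intro!: sum.cong arg_cong2[where f="(*)"])
  moreover have "(\<lambda>x. \<Sum>i<p. (\<Sum>j<p. K $$ (i, j) * vec_index (u x) j) * (\<Sum>j<p. K $$ (i, j) * vec_index (v x) j))
      \<in> borel_measurable M"
    by (intro borel_measurable_sum borel_measurable_times borel_measurable_const) (use assms(2,3) in auto)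
  ultimately show ?thesis by simp
qed

lemma measurable_mvn_density:
  assumes "tri_factor p C L" "m \<in> carrier_vec p"
  shows "mvn_density p m C \<in> borel_measurable (Bvec p)"
proof -
  obtain K where K: "K \<in> carrier_mat p p"
    "\<And>u v. u \<in> carrier_vec p \<Longrightarrow> v \<in> carrier_vec p \<Longrightarrow> qform C u v = scalar_prod (K *\<^sub>v u) (K *\<^sub>v v)"
    using tri_factor_whitening[OF assms(1)] by metis
  have eq: "mvn_density p m C = (\<lambda>x. (2 * pi) powr (- real p / 2) * det C powr (- 1 / 2) *
     exp (- (1 / 2) * scalar_prod (K *\<^sub>v (vec p x - m)) (K *\<^sub>v (vec p x - m))))"
    unfolding mvn_density_def using assms(2) by (intro ext) (simp add: K(2))
  have [measurable]: "(\<lambda>x. scalar_prod (K *\<^sub>v (vec p x - m)) (K *\<^sub>v (vec p x - m))) \<in> borel_measurable (Bvec p)"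
    using assms(2) K(1) by (intro measurable_mult_mat_vec) auto
  show ?thesis unfolding eq by measurable
qed

text \<open>Substituting \<open>x = m + L z\<close> turns the quadratic form in the exponent into
  the squared norm of \<open>z\<close>, while the Jacobian cancels the determinant factor. What
  remains, \<open>dens\<close>, is the product of standard normal densities.\<close>

lemma nn_integral_mvn:
  assumes tf: "tri_factor p C L" and m: "m \<in> carrier_vec p"
    and f [measurable]: "f \<in> borel_measurable (Bvec p)"
  shows "(\<integral>\<^sup>+x. f x \<partial>mvn p m C) = (\<integral>\<^sup>+z. f (aff p (\<lambda>k. vec_index m k) L z) \<partial>gauss p 1)"
proof -
  let ?L = "mat p p (\<lambda>(i, j). L i j)"
  let ?T = "\<lambda>z. aff p (\<lambda>k. vec_index m k) L z"
  let ?P = "\<Prod>k<p. L k k"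
  obtain K where K: "K \<in> carrier_mat p p" "K * ?L = 1\<^sub>m p"
    "\<And>u v. u \<in> carrier_vec p \<Longrightarrow> v \<in> carrier_vec p \<Longrightarrow> qform C u v = scalar_prod (K *\<^sub>v u) (K *\<^sub>v v)"
    and det: "det C = ?P\<^sup>2"
    using tri_factor_whitening[OF tf] by metis
  have low: "\<And>i j. i < j \<Longrightarrow> L i j = 0" and pos: "\<And>i. i < p \<Longrightarrow> 0 < L i i"
    using tf by (auto simp: tri_factor_def)
  have P: "0 < ?P" using pos by (intro prod_pos) auto
  note [measurable] = measurable_mvn_density[OF tf m]
  have sq: "(x\<^sup>2) powr (- 1 / 2) = 1 / x" if "0 < x" for x :: real
    using that by (simp add: powr_minus_divide powr_half_sqrt)
  have dens: "?P * mvn_density p m C (?T z) = (\<Prod>k<p. normal_density 0 1 (z k))" for z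
  proof -
    have "vec p (?T z) - m = ?L *\<^sub>v vec p z"
      unfolding tri_factor_mult_vec[OF K(1,2) m] using m by (intro eq_vecI) auto
    then have "qform C (vec p (?T z) - m) (vec p (?T z) - m) = (\<Sum>k<p. (z k)\<^sup>2)"
      using K(3)[of "?L *\<^sub>v vec p z" "?L *\<^sub>v vec p z"] mult_mat_vec_carrier[of ?L p p "vec p z"]
      by (simp add: tri_factor_mult_vec[OF K(1,2) m])
        (simp add: scalar_prod_def atLeast0LessThan power2_eq_square)
    moreover have "det C powr (- 1 / 2) = 1 / ?P"
      unfolding det by (rule sq[OF P])
    moreover have "(2 * pi) powr (- real p / 2) = (1 / sqrt (2 * pi)) ^ p"
    proof -
      have "1 / sqrt (2 * pi) = (2 * pi) powr (- 1 / 2)"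
        by (simp add: powr_minus_divide powr_half_sqrt)
      then show ?thesis by (simp only:) (simp add: powr_power)
    qed
    moreover have "(\<Prod>k<p. normal_density 0 1 (z k)) = (1 / sqrt (2 * pi)) ^ p * exp (\<Sum>k<p. - (z k)\<^sup>2 / 2)"
      by (simp only: std_normal_density_def prod.distrib exp_sum finite_lessThan prod_constant card_lessThan)
    moreover have "(\<Sum>k<p. - (z k)\<^sup>2 / 2) = - (1 / 2) * (\<Sum>k<p. (z k)\<^sup>2)"
      by (simp add: sum_distrib_left sum_divide_distrib sum_negf)
    ultimately show ?thesis
      using P by (simp add: mvn_density_def) (use pos in fastforce)
  qed
  have "(\<integral>\<^sup>+x. f x \<partial>mvn p m C) = (\<integral>\<^sup>+x. ennreal (mvn_density p m C x) * f x \<partial>Lvec p)"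
    unfolding mvn_def by (intro nn_integral_density) measurable
  also have "\<dots> = ennreal ?P * (\<integral>\<^sup>+z. ennreal (mvn_density p m C (?T z)) * f (?T z) \<partial>Lvec p)"
    by (rule nn_integral_Lvec_triangular) (auto simp: low pos)
  also have "\<dots> = (\<integral>\<^sup>+z. ennreal (\<Prod>k<p. normal_density 0 1 (z k)) * f (?T z) \<partial>Lvec p)"
    using P by (subst nn_integral_cmult[symmetric])
      (auto simp: mult.assoc[symmetric] ennreal_mult'[symmetric] dens)
  also have "\<dots> = (\<integral>\<^sup>+z. f (?T z) \<partial>gauss p 1)"
    by (rule nn_integral_gauss_density[symmetric]) auto
  finally show ?thesis .
qed

lemma sets_mvn [measurable_cong, simp]: "sets (mvn p m C) = sets (Bvec p)"
  by (simp add: mvn_def sets_Lvec)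

text \<open>That the explicit density has total mass one is read off from the transfer to
  \<open>gauss p 1\<close> with a constant integrand.\<close>

lemma prob_space_mvn:
  assumes "tri_factor p C L" "m \<in> carrier_vec p"
  shows "prob_space (mvn p m C)"
proof
  interpret G: prob_space "gauss p 1" by (rule prob_space_gauss) simp
  have "emeasure (mvn p m C) (space (mvn p m C)) = (\<integral>\<^sup>+x. 1 \<partial>mvn p m C)" by simp
  also have "\<dots> = 1"
    by (subst nn_integral_mvn[OF assms]) (use G.emeasure_space_1 in auto)
  finally show "emeasure (mvn p m C) (space (mvn p m C)) = 1" .
qed

section \<open>Sums of independent normal samples\<close>

definition vsum :: "nat \<Rightarrow> nat \<Rightarrow> (nat \<Rightarrow> nat \<Rightarrow> real) \<Rightarrow> nat \<Rightarrow> real" where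
  "vsum p n S = (\<lambda>k\<in>{..<p}. \<Sum>j<n. S j k)"

lemma measurable_vsum [measurable]:
  assumes "\<And>j. j < n \<Longrightarrow> (\<lambda>x. g x j) \<in> measurable M (Bvec p)"
  shows "(\<lambda>x. vsum p n (g x)) \<in> measurable M (Bvec p)"
  unfolding vsum_def
  by (intro measurable_restrict borel_measurable_sum)
     (auto intro!: measurable_compose[OF assms])

text \<open>Adding a sample point convolves \<open>Y\<close> with a standard normal vector and
  raises its coordinate variance by one. The induction runs over sums, leaving the division by
  \<open>n\<close> for later, and starts at \<open>n = 1\<close> because a normal density with
  standard deviation 0 does not represent a point mass.\<close>

lemma nn_integral_iid_sample:
  assumes tf: "tri_factor p Sig L" and "0 < n" and "g \<in> borel_measurable (Bvec p)"
  shows "(\<integral>\<^sup>+S. g (vsum p n S) \<partial>iid_sample p n mu Sig)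
       = (\<integral>\<^sup>+Y. g (aff p (\<lambda>k. real n * mu k) L Y) \<partial>gauss p (sqrt (real n)))"
proof -
  let ?M = "mvn p (vec p mu) Sig"
  interpret M: prob_space ?M by (rule prob_space_mvn[OF tf]) simp
  interpret product_sigma_finite "\<lambda>_::nat. ?M" ..
  note law = nn_integral_mvn[OF tf vec_carrier]
  have comp: "(\<lambda>x. x j) \<in> measurable (PiM I (\<lambda>_. ?M)) (Bvec p)" if "j \<in> I" for I and j :: nat
    using measurable_component_singleton[OF that, of "\<lambda>_. ?M"] by (simp cong: measurable_cong_sets)
  have aff_vec: "aff p (\<lambda>k. vec_index (vec p mu) k) L z = aff p mu L z" for z
    by (auto simp: aff_def)
  show ?thesis
    using assms(2,3)
  proof (induction n arbitrary: g rule: nat_induct_non_zero)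
    case 1
    note [measurable] = 1
    have "(\<integral>\<^sup>+S. g (vsum p 1 S) \<partial>iid_sample p 1 mu Sig) = (\<integral>\<^sup>+S. g (restrict (S 0) {..<p}) \<partial>PiM {0::nat} (\<lambda>_. ?M))"
      by (simp add: iid_sample_def vsum_def lessThan_Suc)
    also have "\<dots> = (\<integral>\<^sup>+x. g (restrict x {..<p}) \<partial>?M)"
      by (rule product_nn_integral_singleton[where f="\<lambda>x. g (restrict x {..<p})"]) (measurable)
    also have "\<dots> = (\<integral>\<^sup>+z. g (restrict (aff p (\<lambda>k. vec_index (vec p mu) k) L z) {..<p}) \<partial>gauss p 1)"
      by (rule law) measurable
    also have "\<dots> = (\<integral>\<^sup>+z. g (aff p mu L z) \<partial>gauss p 1)"
      by (simp add: aff_vec) (simp add: aff_def)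
    finally show ?case by simp
  next
    case (Suc n)
    note [measurable] = Suc.prems
    \<comment> \<open>The factors 1 give the sum the shape required by
      \<open>nn_integral_gauss_conv\<close>.\<close>
    let ?t = "\<lambda>x y. \<lambda>k\<in>{..<p}. 1 * x k + 1 * y k"
    interpret G: prob_space "gauss p 1" by (rule prob_space_gauss) simp
    have "(\<integral>\<^sup>+S. g (vsum p (Suc n) S) \<partial>iid_sample p (Suc n) mu Sig)
      = (\<integral>\<^sup>+S. \<integral>\<^sup>+x. g (vsum p (Suc n) (S(n := x))) \<partial>?M \<partial>PiM {..<n} (\<lambda>_. ?M))"
      unfolding iid_sample_def lessThan_Suc
      by (rule product_nn_integral_insert)
         (auto intro!: measurable_compose[OF _ Suc.prems] measurable_vsum comp)
    also have "\<dots> = (\<integral>\<^sup>+S. \<integral>\<^sup>+x. g (?t (vsum p n S) x) \<partial>?M \<partial>PiM {..<n} (\<lambda>_. ?M))"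
      by (intro nn_integral_cong arg_cong[where f=g]) (auto simp: vsum_def fun_eq_iff intro!: sum.cong)
    also have "\<dots> = (\<integral>\<^sup>+S. \<integral>\<^sup>+z. g (?t (vsum p n S) (aff p mu L z)) \<partial>gauss p 1 \<partial>iid_sample p n mu Sig)"
      unfolding iid_sample_def
    proof (intro nn_integral_cong)
      fix S assume S: "S \<in> space (Pi\<^sub>M {..<n} (\<lambda>_. mvn p (vec p mu) Sig))"
      have [measurable]: "(\<lambda>x. g (?t (vsum p n S) x)) \<in> borel_measurable (Bvec p)"
        by measurable
      show "(\<integral>\<^sup>+x. g (?t (vsum p n S) x) \<partial>?M) = (\<integral>\<^sup>+z. g (?t (vsum p n S) (aff p mu L z)) \<partial>gauss p 1)"
        by (subst law) (auto simp: aff_vec)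
    qed
    also have "\<dots> = (\<integral>\<^sup>+Y. \<integral>\<^sup>+z. g (?t (aff p (\<lambda>k. real n * mu k) L Y) (aff p mu L z)) \<partial>gauss p 1 \<partial>gauss p (sqrt (real n)))"
      by (rule Suc.IH) measurable
    also have "\<dots> = (\<integral>\<^sup>+Y. \<integral>\<^sup>+z. g (aff p (\<lambda>k. real (Suc n) * mu k) L (?t Y z)) \<partial>gauss p 1 \<partial>gauss p (sqrt (real n)))"
      by (intro nn_integral_cong arg_cong[where f=g])
         (auto simp: aff_def fun_eq_iff algebra_simps sum.distrib)
    also have "\<dots> = (\<integral>\<^sup>+Y. g (aff p (\<lambda>k. real (Suc n) * mu k) L Y) \<partial>gauss p (sqrt (1\<^sup>2 * (sqrt (real n))\<^sup>2 + 1\<^sup>2 * 1\<^sup>2)))"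
      using Suc.hyps by (intro nn_integral_gauss_conv) auto
    finally show ?case by (simp add: add.commute)
  qed
qed

section \<open>The unconditional law of the sample means\<close>

text \<open>Converts one level of a nested Bochner integral. Measurability of \<open>I\<close> comes
  from \<open>J\<close>, since \<open>I\<close> agrees with \<open>enn2real\<close> of
  \<open>J\<close> on the space; the bounds reappear in the conclusion so that the result can serve
  as integrand of the next level.\<close>

lemma ennreal_integral_unit_interval:
  fixes I :: "'a \<Rightarrow> real"
  assumes "prob_space M" and [measurable]: "J \<in> borel_measurable M"
    and I: "\<And>x. x \<in> space M \<Longrightarrow> ennreal (I x) = J x \<and> 0 \<le> I x \<and> I x \<le> 1"
  shows "ennreal (\<integral>x. I x \<partial>M) = (\<integral>\<^sup>+x. J x \<partial>M) \<and> 0 \<le> (\<integral>x. I x \<partial>M) \<and> (\<integral>x. I x \<partial>M) \<le> 1"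
proof -
  interpret prob_space M by fact
  have "I x = enn2real (J x)" if "x \<in> space M" for x
    using I[OF that] by (metis enn2real_ennreal)
  then have [measurable]: "I \<in> borel_measurable M"
    by (subst measurable_cong[of M I "\<lambda>x. enn2real (J x)"]) auto
  have int: "integrable M I"
    by (rule integrable_const_bound[where B=1]) (use I in auto)
  have "(\<integral>\<^sup>+x. J x \<partial>M) = (\<integral>\<^sup>+x. ennreal (I x) \<partial>M)"
    using I by (intro nn_integral_cong) simp
  also have "\<dots> = ennreal (\<integral>x. I x \<partial>M)"
    using int I by (intro nn_integral_eq_integral) auto
  finally have "ennreal (\<integral>x. I x \<partial>M) = (\<integral>\<^sup>+x. J x \<partial>M)" ..
  moreover have "(\<integral>x. I x \<partial>M) \<le> 1"
    using integral_mono[OF int integrable_const[of 1]] I by (simp add: prob_space)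
  ultimately show ?thesis using I by (auto intro!: integral_nonneg_AE)
qed

definition smul :: "nat \<Rightarrow> real \<Rightarrow> (nat \<Rightarrow> real) \<Rightarrow> nat \<Rightarrow> real" where
  "smul p c y = (\<lambda>k\<in>{..<p}. c * y k)"

lemma measurable_smul [measurable]:
  assumes [measurable]: "g \<in> measurable M (Bvec p)"
  shows "(\<lambda>x. smul p c (g x)) \<in> measurable M (Bvec p)"
  unfolding smul_def
  by (intro measurable_restrict) auto

lemma sample_mean_eq: "sample_mean p n S = vec p (smul p (1 / real n) (vsum p n S))"
  by (auto simp: sample_mean_def smul_def vsum_def)

lemma nn_integral_sample_mean:
  assumes "tri_factor p Sig L" "0 < n" and [measurable]: "g \<in> borel_measurable (Bvec p)"
  shows "(\<integral>\<^sup>+S. g (smul p (1 / real n) (vsum p n S)) \<partial>iid_sample p n mu Sig)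
       = (\<integral>\<^sup>+Y. g (aff p mu L (smul p (1 / real n) Y)) \<partial>gauss p (sqrt (real n)))"
proof -
  have "smul p (1 / real n) (aff p (\<lambda>k. real n * mu k) L Y) = aff p mu L (smul p (1 / real n) Y)" for Y
    using assms(2) by (auto simp: smul_def aff_def fun_eq_iff add_divide_distrib sum_divide_distrib)
  moreover have "(\<integral>\<^sup>+S. g (smul p (1 / real n) (vsum p n S)) \<partial>iid_sample p n mu Sig)
     = (\<integral>\<^sup>+Y. g (smul p (1 / real n) (aff p (\<lambda>k. real n * mu k) L Y)) \<partial>gauss p (sqrt (real n)))"
    by (rule nn_integral_iid_sample[OF assms(1,2)]) measurable
  ultimately show ?thesis by simp
qed

lemma nn_integral_mvn_scaled:
  assumes tf: "tri_factor p Sig L" "0 < c" "m \<in> carrier_vec p" and [measurable]: "g \<in> borel_measurable (Bvec p)"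
  shows "(\<integral>\<^sup>+x. g x \<partial>mvn p m (c \<cdot>\<^sub>m Sig)) = (\<integral>\<^sup>+z. g (aff p (vec_index m) L (smul p (sqrt c) z)) \<partial>gauss p 1)"
proof -
  have "aff p (vec_index m) (\<lambda>i j. sqrt c * L i j) z = aff p (vec_index m) L (smul p (sqrt c) z)" for z
    by (auto simp: aff_def smul_def fun_eq_iff mult_ac intro!: sum.cong)
  then show ?thesis
    using nn_integral_mvn[OF tri_factor_scale[OF tf(1,2)] tf(3) assms(4)] by simp
qed

lemma prob_space_iid_sample:
  "tri_factor p Sig L \<Longrightarrow> prob_space (iid_sample p n mu Sig)"
  unfolding iid_sample_def by (intro prob_space_PiM prob_space_mvn) auto

lemma measurable_iid_sample_component:
  "j < n \<Longrightarrow> (\<lambda>S. S j) \<in> measurable (iid_sample p n mu Sig) (Bvec p)"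
  using measurable_component_singleton[of j "{..<n}" "\<lambda>_. mvn p (vec p mu) Sig"]
  by (simp add: iid_sample_def cong: measurable_cong_sets)

text \<open>For each class the mean is \<open>m + L z / sqrt nu\<close> and the sample mean adds
  \<open>L Y / n\<close>, where \<open>Y\<close> has coordinate variance \<open>n\<close>. The two
  noises combine to one vector of coordinate variance \<open>1 / nu + 1 / n\<close>. The second
  claim allows the real value to be recovered from its image under \<open>ennreal\<close>.\<close>

lemma model_expect_gauss:
  fixes f :: "real vec \<Rightarrow> real vec \<Rightarrow> real"
  assumes tf: "tri_factor p Sig L" and n: "0 < n0" "0 < n1" and nu: "0 < nu0" "0 < nu1"
    and m: "m0 \<in> carrier_vec p" "m1 \<in> carrier_vec p"
    and f: "\<And>x y. 0 \<le> f x y \<and> f x y \<le> 1"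
    and f_meas: "(\<lambda>(x, y). f (vec p x) (vec p y)) \<in> borel_measurable (Bvec p \<Otimes>\<^sub>M Bvec p)"
  shows "ennreal (model_expect p Sig n0 n1 nu0 nu1 m0 m1 f) =
      (\<integral>\<^sup>+y0. \<integral>\<^sup>+y1. ennreal (f (vec p (aff p (vec_index m0) L y0)) (vec p (aff p (vec_index m1) L y1)))
        \<partial>gauss p (sqrt (1 / nu1 + 1 / real n1)) \<partial>gauss p (sqrt (1 / nu0 + 1 / real n0)))"
    and "0 \<le> model_expect p Sig n0 n1 nu0 nu1 m0 m1 f"
proof -
  note [measurable] = measurable_iid_sample_component
  define H where "H x y = ennreal (f (vec p x) (vec p y))" for x y
  have H [measurable]: "(\<lambda>x. H (g x) (h x)) \<in> borel_measurable M"
    if "g \<in> measurable M (Bvec p)" "h \<in> measurable M (Bvec p)" for g h and M :: "'z measure"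
    unfolding H_def
    using measurable_compose[OF measurable_Pair[OF that] f_meas] by simp
  define N0 N1 where "N0 = gauss p (sqrt (real n0))" and "N1 = gauss p (sqrt (real n1))"
  define Z where "Z = gauss p 1"
  interpret N0: prob_space N0 unfolding N0_def by (rule prob_space_gauss) (use n in simp)
  interpret N1: prob_space N1 unfolding N1_def by (rule prob_space_gauss) (use n in simp)
  interpret Z: prob_space Z unfolding Z_def by (rule prob_space_gauss) simp
  have [measurable_cong]: "sets N0 = sets (Bvec p)" "sets N1 = sets (Bvec p)" "sets Z = sets (Bvec p)"
    by (simp_all add: N0_def N1_def Z_def)
  have comp: "(\<lambda>x. b x k) \<in> borel_measurable M" if "b \<in> measurable M (Bvec p)" "k < p"
    for b k and M :: "'z measure"
    using measurable_compose[OF that(1) measurable_Bvec_component[OF that(2)]] .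
  have aff_m [measurable]: "(\<lambda>x. aff p (b x) L (g x)) \<in> measurable M (Bvec p)"
    if "b \<in> measurable M (Bvec p)" "g \<in> measurable M (Bvec p)" for b g and M :: "'z measure"
    by (intro measurable_aff comp that)
  let ?s0 = "smul p (1 / real n0)" and ?s1 = "smul p (1 / real n1)"
  let ?p0 = "smul p (sqrt (1 / nu0))" and ?p1 = "smul p (sqrt (1 / nu1))"
  let ?A0 = "\<lambda>y. aff p (vec_index m0) L y" and ?A1 = "\<lambda>y. aff p (vec_index m1) L y"
  have A [measurable]: "?A0 \<in> measurable (Bvec p) (Bvec p)" "?A1 \<in> measurable (Bvec p) (Bvec p)"
    by (auto intro!: measurable_aff)
  \<comment> \<open>\<open>J3\<close>, \<open>J2\<close> and \<open>J1\<close> are the integrals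
    over \<open>S1\<close>, then \<open>S0\<close>, then \<open>mu1\<close>, rewritten over Gaussian
    vectors. Their measurability in the remaining variables is what carries the real integrals
    \<open>I3\<close>, \<open>I2\<close> and \<open>I1\<close> along.\<close>
  define J3 where "J3 a mu = (\<integral>\<^sup>+Y1. H a (aff p mu L (?s1 Y1)) \<partial>N1)" for a mu
  have J3 [measurable]: "(\<lambda>x. J3 (g x) (h x)) \<in> borel_measurable M"
    if [measurable]: "g \<in> measurable M (Bvec p)" "h \<in> measurable M (Bvec p)" for g h and M :: "'z measure"
    unfolding J3_def by measurable
  define J2 where "J2 mu0 mu1 = (\<integral>\<^sup>+Y0. J3 (aff p mu0 L (?s0 Y0)) mu1 \<partial>N0)" for mu0 mu1
  have J2 [measurable]: "(\<lambda>x. J2 (g x) (h x)) \<in> borel_measurable M"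
    if [measurable]: "g \<in> measurable M (Bvec p)" "h \<in> measurable M (Bvec p)" for g h and M :: "'z measure"
    unfolding J2_def by measurable
  define J1 where "J1 mu0 = (\<integral>\<^sup>+z1. J2 mu0 (?A1 (?p1 z1)) \<partial>Z)" for mu0
  have J1 [measurable]: "(\<lambda>x. J1 (g x)) \<in> borel_measurable M"
    if [measurable]: "g \<in> measurable M (Bvec p)" for g and M :: "'z measure"
    unfolding J1_def by measurable
  define I3 where "I3 x mu = (\<integral>S1. f x (sample_mean p n1 S1) \<partial>iid_sample p n1 mu Sig)" for x mu
  have I3: "ennreal (I3 (vec p a) mu) = J3 a mu \<and> 0 \<le> I3 (vec p a) mu \<and> I3 (vec p a) mu \<le> 1"
    if a [measurable]: "a \<in> space (Bvec p)" and mu [measurable]: "mu \<in> space (Bvec p)" for a mu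
  proof -
    have "J3 a mu = (\<integral>\<^sup>+S. H a (?s1 (vsum p n1 S)) \<partial>iid_sample p n1 mu Sig)"
      unfolding J3_def N1_def by (rule nn_integral_sample_mean[OF tf n(2), symmetric]) measurable
    then show ?thesis
      using ennreal_integral_unit_interval[OF prob_space_iid_sample[OF tf],
          of "\<lambda>S. H a (?s1 (vsum p n1 S))" n1 mu "\<lambda>S. f (vec p a) (sample_mean p n1 S)"] f
      by (simp add: I3_def H_def[symmetric] sample_mean_eq)
  qed
  define I2 where "I2 mu0 mu1 = (\<integral>S0. I3 (sample_mean p n0 S0) mu1 \<partial>iid_sample p n0 mu0 Sig)" for mu0 mu1
  have I2: "ennreal (I2 mu0 mu1) = J2 mu0 mu1 \<and> 0 \<le> I2 mu0 mu1 \<and> I2 mu0 mu1 \<le> 1"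
    if [measurable]: "mu0 \<in> space (Bvec p)" "mu1 \<in> space (Bvec p)" for mu0 mu1
  proof -
    have "J2 mu0 mu1 = (\<integral>\<^sup>+S. J3 (?s0 (vsum p n0 S)) mu1 \<partial>iid_sample p n0 mu0 Sig)"
      unfolding J2_def N0_def by (rule nn_integral_sample_mean[OF tf n(1), symmetric]) measurable
    moreover have "?s0 (vsum p n0 S) \<in> space (Bvec p)" for S
      by (auto simp: space_PiM smul_def)
    ultimately show ?thesis
      using ennreal_integral_unit_interval[OF prob_space_iid_sample[OF tf],
          of "\<lambda>S. J3 (?s0 (vsum p n0 S)) mu1" n0 mu0 "\<lambda>S. I3 (sample_mean p n0 S) mu1"] I3 that
      by (simp add: I2_def sample_mean_eq)
  qed
  have nu': "0 < 1 / nu0" "0 < 1 / nu1" using nu by auto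
  have pr: "prob_space (mvn p m ((1 / nu) \<cdot>\<^sub>m Sig))" if "m \<in> carrier_vec p" "0 < 1 / nu" for m nu
    using prob_space_mvn[OF tri_factor_scale[OF tf that(2)] that(1)] .
  define I1 where "I1 mu0 = (\<integral>mu1. I2 mu0 mu1 \<partial>mvn p m1 ((1 / nu1) \<cdot>\<^sub>m Sig))" for mu0
  have I1: "ennreal (I1 mu0) = J1 mu0 \<and> 0 \<le> I1 mu0 \<and> I1 mu0 \<le> 1"
    if [measurable]: "mu0 \<in> space (Bvec p)" for mu0
  proof -
    have "J1 mu0 = (\<integral>\<^sup>+mu1. J2 mu0 mu1 \<partial>mvn p m1 ((1 / nu1) \<cdot>\<^sub>m Sig))"
      unfolding J1_def Z_def by (rule nn_integral_mvn_scaled[OF tf nu'(2) m(2), symmetric]) measurable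
    moreover have "J2 mu0 \<in> borel_measurable (mvn p m1 ((1 / nu1) \<cdot>\<^sub>m Sig))"
      by (rule J2[of "\<lambda>_. mu0" _ "\<lambda>x. x"]) (simp_all add: that measurable_ident_sets)
    ultimately show ?thesis
      using ennreal_integral_unit_interval[OF pr[OF m(2) nu'(2)], of "J2 mu0" "I2 mu0"] I2 that
      by (simp add: I1_def sets_eq_imp_space_eq[OF sets_mvn])
  qed
  let ?I0 = "model_expect p Sig n0 n1 nu0 nu1 m0 m1 f"
  have I0_eq: "?I0 = (\<integral>mu0. I1 mu0 \<partial>mvn p m0 ((1 / nu0) \<cdot>\<^sub>m Sig))"
    by (simp add: model_expect_def I1_def I2_def I3_def)
  have I0: "ennreal ?I0 = (\<integral>\<^sup>+mu0. J1 mu0 \<partial>mvn p m0 ((1 / nu0) \<cdot>\<^sub>m Sig)) \<and> 0 \<le> ?I0 \<and> ?I0 \<le> 1"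
    unfolding I0_eq
    by (rule ennreal_integral_unit_interval[OF pr[OF m(1) nu'(1)]])
       (auto simp: I1 sets_eq_imp_space_eq[OF sets_mvn] measurable_ident_sets intro: J1[of "\<lambda>x. x"])
  then show "0 \<le> ?I0" by simp
  let ?t0 = "\<lambda>z Y. \<lambda>k\<in>{..<p}. sqrt (1 / nu0) * z k + (1 / real n0) * Y k"
  let ?t1 = "\<lambda>z Y. \<lambda>k\<in>{..<p}. sqrt (1 / nu1) * z k + (1 / real n1) * Y k"
  have t_m [measurable]: "(\<lambda>x. ?t0 (g x) (h x)) \<in> measurable M (Bvec p)"
    "(\<lambda>x. ?t1 (g x) (h x)) \<in> measurable M (Bvec p)"
    if [measurable]: "g \<in> measurable M (Bvec p)" "h \<in> measurable M (Bvec p)" for g h and M :: "'z measure"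
    by (intro measurable_restrict borel_measurable_add borel_measurable_times borel_measurable_const comp that; simp)+
  have comb0: "aff p (?A0 (?p0 z)) L (?s0 Y) = ?A0 (?t0 z Y)" for z Y
    by (auto simp: aff_def smul_def fun_eq_iff algebra_simps sum.distrib)
  have comb1: "aff p (?A1 (?p1 z)) L (?s1 Y) = ?A1 (?t1 z Y)" for z Y
    by (auto simp: aff_def smul_def fun_eq_iff algebra_simps sum.distrib)
  define G1 where "G1 = gauss p (sqrt (1 / nu1 + 1 / real n1))"
  interpret G1: prob_space G1
    unfolding G1_def by (rule prob_space_gauss) (use n nu in \<open>simp add: add_pos_pos\<close>)
  have [measurable_cong]: "sets G1 = sets (Bvec p)" by (simp add: G1_def)
  interpret P: pair_sigma_finite Z N0 ..
  have "ennreal ?I0 = (\<integral>\<^sup>+z0. J1 (?A0 (?p0 z0)) \<partial>Z)"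
    unfolding I0[THEN conjunct1] Z_def by (rule nn_integral_mvn_scaled[OF tf nu'(1) m(1)]) measurable
  also have "\<dots> = (\<integral>\<^sup>+z0. \<integral>\<^sup>+z1. \<integral>\<^sup>+Y0. \<integral>\<^sup>+Y1. H (?A0 (?t0 z0 Y0)) (?A1 (?t1 z1 Y1)) \<partial>N1 \<partial>N0 \<partial>Z \<partial>Z)"
    unfolding J1_def J2_def J3_def comb0 comb1 ..
  \<comment> \<open>The model draws both means before both samples; exchanging \<open>z1\<close> and
    \<open>Y0\<close> groups the noise by class, ready for convolution.\<close>
  also have "\<dots> = (\<integral>\<^sup>+z0. \<integral>\<^sup>+Y0. \<integral>\<^sup>+z1. \<integral>\<^sup>+Y1. H (?A0 (?t0 z0 Y0)) (?A1 (?t1 z1 Y1)) \<partial>N1 \<partial>Z \<partial>N0 \<partial>Z)"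
    by (intro nn_integral_cong P.Fubini'[symmetric]) measurable
  also have "\<dots> = (\<integral>\<^sup>+z0. \<integral>\<^sup>+Y0. \<integral>\<^sup>+y1. H (?A0 (?t0 z0 Y0)) (?A1 y1) \<partial>G1 \<partial>N0 \<partial>Z)"
  proof (intro nn_integral_cong)
    fix z0 Y0 assume "z0 \<in> space Z" "Y0 \<in> space N0"
    then have [measurable]: "?A0 (?t0 z0 Y0) \<in> space (Bvec p)" by (auto simp: aff_def space_PiM)
    have "(\<integral>\<^sup>+z1. \<integral>\<^sup>+Y1. H (?A0 (?t0 z0 Y0)) (?A1 (?t1 z1 Y1)) \<partial>N1 \<partial>Z)
      = (\<integral>\<^sup>+y1. H (?A0 (?t0 z0 Y0)) (?A1 y1) \<partial>gauss p (sqrt ((sqrt (1 / nu1))\<^sup>2 * 1\<^sup>2 + (1 / real n1)\<^sup>2 * (sqrt (real n1))\<^sup>2)))"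
      unfolding Z_def N1_def
      by (rule nn_integral_gauss_conv[where f="\<lambda>y. H (?A0 (?t0 z0 Y0)) (?A1 y)"]) (use n nu in \<open>simp_all\<close>)
    also have "sqrt ((sqrt (1 / nu1))\<^sup>2 * 1\<^sup>2 + (1 / real n1)\<^sup>2 * (sqrt (real n1))\<^sup>2) = sqrt (1 / nu1 + 1 / real n1)"
      using n nu by (simp add: power2_eq_square)
    finally show "(\<integral>\<^sup>+z1. \<integral>\<^sup>+Y1. H (?A0 (?t0 z0 Y0)) (?A1 (?t1 z1 Y1)) \<partial>N1 \<partial>Z)
      = (\<integral>\<^sup>+y1. H (?A0 (?t0 z0 Y0)) (?A1 y1) \<partial>G1)" unfolding G1_def .
  qed
  also have "\<dots> = (\<integral>\<^sup>+y0. \<integral>\<^sup>+y1. H (?A0 y0) (?A1 y1) \<partial>G1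
      \<partial>gauss p (sqrt ((sqrt (1 / nu0))\<^sup>2 * 1\<^sup>2 + (1 / real n0)\<^sup>2 * (sqrt (real n0))\<^sup>2)))"
    unfolding Z_def N0_def
    by (rule nn_integral_gauss_conv[where f="\<lambda>y0. \<integral>\<^sup>+y1. H (?A0 y0) (?A1 y1) \<partial>G1"]) (use n nu in \<open>simp_all\<close>)
  also have "sqrt ((sqrt (1 / nu0))\<^sup>2 * 1\<^sup>2 + (1 / real n0)\<^sup>2 * (sqrt (real n0))\<^sup>2) = sqrt (1 / nu0 + 1 / real n0)"
    using n nu by (simp add: power2_eq_square)
  finally show "ennreal ?I0 =
      (\<integral>\<^sup>+y0. \<integral>\<^sup>+y1. ennreal (f (vec p (?A0 y0)) (vec p (?A1 y1)))
        \<partial>gauss p (sqrt (1 / nu1 + 1 / real n1)) \<partial>gauss p (sqrt (1 / nu0 + 1 / real n0)))"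
    by (simp add: H_def G1_def)
qed

section \<open>Moments and concentration\<close>

lemma gauss1_moments:
  assumes "0 < s"
  shows "has_bochner_integral (gauss1 s) (\<lambda>x. x) 0"
    and "has_bochner_integral (gauss1 s) (\<lambda>x. x\<^sup>2) (s\<^sup>2)"
    and "has_bochner_integral (gauss1 s) (\<lambda>x. x ^ 4) (3 * s ^ 4)"
proof -
  show "has_bochner_integral (gauss1 s) (\<lambda>x. x) 0"
    using normal_moment_odd[OF assms, of 0 0] by (intro has_bochner_integral_density) auto
  show "has_bochner_integral (gauss1 s) (\<lambda>x. x\<^sup>2) (s\<^sup>2)"
    using normal_moment_even[OF assms, of 0 1] by (intro has_bochner_integral_density) (auto simp: fact_numeral)
  show "has_bochner_integral (gauss1 s) (\<lambda>x. x ^ 4) (3 * s ^ 4)"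
    using normal_moment_even[OF assms, of 0 2]
    by (intro has_bochner_integral_density) (auto simp: fact_numeral power_divide power_mult[symmetric])
qed

text \<open>Variances of independent centred terms add, as the cross term vanishes when the last
  coordinate is integrated. A separate \<open>g k\<close> for each coordinate covers both weighted
  linear forms and centred squares.\<close>

lemma nn_integral_gauss_centred_sum_sq:
  assumes s: "0 < s"
    and g0: "\<And>k. k < p \<Longrightarrow> has_bochner_integral (gauss1 s) (g k) 0"
    and g2: "\<And>k. k < p \<Longrightarrow> has_bochner_integral (gauss1 s) (\<lambda>x. (g k x)\<^sup>2) (v k)"
  shows "(\<integral>\<^sup>+y. ennreal ((\<Sum>k<p. g k (y k))\<^sup>2) \<partial>gauss p s) = ennreal (\<Sum>k<p. v k)"
  using g0 g2
proof (induction p)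
  case 0
  then show ?case by simp
next
  case (Suc p)
  interpret N: prob_space "gauss1 s" by (intro prob_space_normal_density) fact
  interpret G: prob_space "gauss p s" by (rule prob_space_gauss) fact
  \<comment> \<open>Nonnegativity of \<open>v k\<close>, as the integral of a square, allows
    \<open>ennreal\<close> of the sum to be split.\<close>
  have v: "0 \<le> v k" if "k < Suc p" for k
    using has_bochner_integral_integral_eq[OF Suc.prems(2)[OF that]]
      Bochner_Integration.integral_nonneg[of "gauss1 s" "\<lambda>x. (g k x)\<^sup>2"] by simp
  have [measurable]: "g k \<in> borel_measurable borel" if "k < Suc p" for k
    using Suc.prems(1)[OF that] by (auto simp: has_bochner_integral_iff dest: borel_measurable_integrable)
  have sum [measurable]: "(\<lambda>y. \<Sum>k<q. g k (y k)) \<in> borel_measurable (Bvec q)" if "q \<le> Suc p" for q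
    using that by (intro borel_measurable_sum) auto
  have inner: "(\<integral>\<^sup>+t. ennreal ((a + g p t)\<^sup>2) \<partial>gauss1 s) = ennreal (a\<^sup>2) + ennreal (v p)" for a
  proof -
    have "has_bochner_integral (gauss1 s) (\<lambda>t. a\<^sup>2 + 2 * a * g p t + (g p t)\<^sup>2) (a\<^sup>2 + 2 * a * 0 + v p)"
      using Suc.prems(1)[of p] Suc.prems(2)[of p] N.prob_space
      by (intro has_bochner_integral_add has_bochner_integral_mult_right)
         (auto simp: has_bochner_integral_iff)
    then have "has_bochner_integral (gauss1 s) (\<lambda>t. (a + g p t)\<^sup>2) (a\<^sup>2 + v p)"
      by (simp add: power2_sum algebra_simps)
    then have "(\<integral>\<^sup>+t. ennreal ((a + g p t)\<^sup>2) \<partial>gauss1 s) = ennreal (a\<^sup>2 + v p)"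
      by (subst nn_integral_eq_integral) (auto simp: has_bochner_integral_iff)
    then show ?thesis using v[of p] by simp
  qed
  have "(\<integral>\<^sup>+y. ennreal ((\<Sum>k<Suc p. g k (y k))\<^sup>2) \<partial>gauss (Suc p) s)
    = (\<integral>\<^sup>+x. \<integral>\<^sup>+t. ennreal ((\<Sum>k<Suc p. g k ((x(p := t)) k))\<^sup>2) \<partial>gauss1 s \<partial>gauss p s)"
    using sum[of "Suc p"] by (intro nn_integral_gauss_Suc s) (simp del: sum.lessThan_Suc)
  also have "\<dots> = (\<integral>\<^sup>+x. \<integral>\<^sup>+t. ennreal (((\<Sum>k<p. g k (x k)) + g p t)\<^sup>2) \<partial>gauss1 s \<partial>gauss p s)"
    by (intro nn_integral_cong arg_cong[where f="\<lambda>x. ennreal (x\<^sup>2)"]) (auto intro!: sum.cong)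
  also have "\<dots> = (\<integral>\<^sup>+x. ennreal ((\<Sum>k<p. g k (x k))\<^sup>2) + ennreal (v p) \<partial>gauss p s)"
    by (simp only: inner)
  also have "\<dots> = ennreal (\<Sum>k<p. v k) + ennreal (v p)"
    using Suc.IH[OF Suc.prems] sum[of p] G.emeasure_space_1
    by (subst nn_integral_add) auto
  also have "\<dots> = ennreal (\<Sum>k<Suc p. v k)"
    using v[of p] sum_nonneg[of "{..<p}" v] v by simp
  finally show ?case .
qed

section \<open>Second moments of inner products of Gaussian vectors\<close>

definition ip :: "nat \<Rightarrow> (nat \<Rightarrow> real) \<Rightarrow> (nat \<Rightarrow> real) \<Rightarrow> real" where
  "ip p u v = (\<Sum>k<p. u k * v k)"

lemma measurable_ip [measurable]:
  assumes [measurable]: "\<And>k. k < p \<Longrightarrow> (\<lambda>x. u x k) \<in> borel_measurable M"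
    "\<And>k. k < p \<Longrightarrow> (\<lambda>x. v x k) \<in> borel_measurable M"
  shows "(\<lambda>x. ip p (u x) (v x)) \<in> borel_measurable M"
  unfolding ip_def by (intro borel_measurable_sum borel_measurable_times) auto

lemma nn_integral_gauss_ip_sq:
  assumes "0 < s"
  shows "(\<integral>\<^sup>+y. ennreal ((ip p w y)\<^sup>2) \<partial>gauss p s) = ennreal (s\<^sup>2 * ip p w w)"
proof -
  have "(\<integral>\<^sup>+y. ennreal ((\<Sum>k<p. w k * y k)\<^sup>2) \<partial>gauss p s) = ennreal (\<Sum>k<p. (w k)\<^sup>2 * s\<^sup>2)"
  proof (rule nn_integral_gauss_centred_sum_sq[OF assms])
    fix k
    show "has_bochner_integral (gauss1 s) (\<lambda>x. w k * x) 0"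
      using has_bochner_integral_mult_right[OF gauss1_moments(1)[OF assms], of "w k"] by simp
    show "has_bochner_integral (gauss1 s) (\<lambda>x. (w k * x)\<^sup>2) ((w k)\<^sup>2 * s\<^sup>2)"
      unfolding power_mult_distrib
      using has_bochner_integral_mult_right[OF gauss1_moments(2)[OF assms], of "(w k)\<^sup>2"] by simp
  qed
  then show ?thesis by (simp add: ip_def sum_distrib_left power2_eq_square mult_ac)
qed

lemma nn_integral_gauss_norm_sq:
  assumes "0 < s"
  shows "(\<integral>\<^sup>+y. ennreal (ip p y y) \<partial>gauss p s) = ennreal (real p * s\<^sup>2)"
proof -
  \<comment> \<open>A coordinate is the inner product with a unit vector.\<close>
  have "(\<integral>\<^sup>+y. ennreal ((y k)\<^sup>2) \<partial>gauss p s) = ennreal (s\<^sup>2)" if "k < p" for k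
    using nn_integral_gauss_ip_sq[OF assms, of p "\<lambda>i. if i = k then 1 else 0"] that
    by (simp add: ip_def if_distrib[of "\<lambda>x. x * _"] cong: if_cong)
  then have "(\<integral>\<^sup>+y. (\<Sum>k<p. ennreal ((y k)\<^sup>2)) \<partial>gauss p s) = (\<Sum>k<p. ennreal (s\<^sup>2))"
    by (subst nn_integral_sum) (auto intro!: sum.cong)
  then show ?thesis by (simp add: ip_def power2_eq_square ennreal_mult ennreal_of_nat_eq_real_of_nat)
qed

text \<open>Each centred square has variance \<open>3 * s ^ 4 - s ^ 4\<close>. The total is grouped
  as a multiple of \<open>(p * s^2) * s^2\<close> because the first factor converges and the second
  vanishes in the asymptotic regime.\<close>

lemma nn_integral_gauss_norm_sq_deviation:
  assumes "0 < s"
  shows "(\<integral>\<^sup>+y. ennreal ((ip p y y - real p * s\<^sup>2)\<^sup>2) \<partial>gauss p s) = ennreal (2 * (real p * s\<^sup>2) * s\<^sup>2)"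
proof -
  interpret N: prob_space "gauss1 s" by (intro prob_space_normal_density) fact
  have c: "has_bochner_integral (gauss1 s) (\<lambda>x. b) b" for b :: real
    using N.prob_space by (auto simp: has_bochner_integral_iff)
  have "(\<integral>\<^sup>+y. ennreal ((\<Sum>k<p. (y k)\<^sup>2 - s\<^sup>2)\<^sup>2) \<partial>gauss p s) = ennreal (\<Sum>k<p. 2 * s ^ 4)"
  proof (rule nn_integral_gauss_centred_sum_sq[OF assms])
    fix k
    show "has_bochner_integral (gauss1 s) (\<lambda>x. x\<^sup>2 - s\<^sup>2) 0"
      using has_bochner_integral_diff[OF gauss1_moments(2)[OF assms] c[of "s\<^sup>2"]] by simp
    have "has_bochner_integral (gauss1 s) (\<lambda>x. x ^ 4 - 2 * s\<^sup>2 * x\<^sup>2 + s ^ 4) (3 * s ^ 4 - 2 * s\<^sup>2 * s\<^sup>2 + s ^ 4)"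
      by (intro has_bochner_integral_add has_bochner_integral_diff has_bochner_integral_mult_right
          gauss1_moments assms c)
    moreover have "x ^ 4 - 2 * s\<^sup>2 * x\<^sup>2 + s ^ 4 = (x\<^sup>2 - s\<^sup>2)\<^sup>2" for x
      by (simp add: power4_eq_xxxx power2_eq_square algebra_simps)
    moreover have "3 * s ^ 4 - 2 * s\<^sup>2 * s\<^sup>2 + s ^ 4 = 2 * s ^ 4"
      by (simp add: power4_eq_xxxx power2_eq_square)
    ultimately show "has_bochner_integral (gauss1 s) (\<lambda>x. (x\<^sup>2 - s\<^sup>2)\<^sup>2) (2 * s ^ 4)" by simp
  qed
  moreover have "real p * (2 * s ^ 4) = 2 * (real p * s\<^sup>2) * s\<^sup>2"
    by (simp add: power4_eq_xxxx power2_eq_square)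
  ultimately show ?thesis by (simp add: ip_def sum_subtractf power2_eq_square)
qed

text \<open>For fixed \<open>x\<close> this is a linear form in \<open>y\<close>, with variance
  \<open>t^2\<close> times the squared norm of \<open>x\<close>.\<close>

lemma nn_integral_gauss_cross_sq:
  assumes "0 < s" "0 < t"
  shows "(\<integral>\<^sup>+x. \<integral>\<^sup>+y. ennreal ((ip p x y)\<^sup>2) \<partial>gauss p t \<partial>gauss p s) = ennreal (t\<^sup>2 * (real p * s\<^sup>2))"
proof -
  have "(\<integral>\<^sup>+x. \<integral>\<^sup>+y. ennreal ((ip p x y)\<^sup>2) \<partial>gauss p t \<partial>gauss p s)
      = (\<integral>\<^sup>+x. ennreal (t\<^sup>2) * ennreal (ip p x x) \<partial>gauss p s)"
    unfolding nn_integral_gauss_ip_sq[OF assms(2)]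
    by (intro nn_integral_cong) (simp add: ennreal_mult ip_def sum_nonneg)
  also have "\<dots> = ennreal (t\<^sup>2) * ennreal (real p * s\<^sup>2)"
    by (subst nn_integral_cmult) (auto simp: nn_integral_gauss_norm_sq[OF assms(1)])
  finally show ?thesis by (simp add: ennreal_mult)
qed

text \<open>The hypothesis \<open>lim\<close> says that \<open>f p x\<close> is near
  \<open>l\<close> once \<open>p\<close> is large and \<open>D p x\<close> is small. The remaining
  points are handled as in Markov's inequality, by boundedness of \<open>f\<close> and the vanishing
  mean of \<open>D\<close>.\<close>

lemma expectation_tendsto_of_concentration:
  fixes M :: "nat \<Rightarrow> 'a measure" and f D :: "nat \<Rightarrow> 'a \<Rightarrow> real"
  assumes "\<And>p. prob_space (M p)"
    and [measurable]: "\<And>p. f p \<in> borel_measurable (M p)" "\<And>p. D p \<in> borel_measurable (M p)"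
    and f: "\<And>p x. 0 \<le> f p x \<and> f p x \<le> 1" and D: "\<And>p x. 0 \<le> D p x"
    and e: "\<And>p. (\<integral>\<^sup>+x. ennreal (D p x) \<partial>M p) \<le> ennreal (e p)" "e \<longlonglongrightarrow> 0" "\<And>p. 0 \<le> e p"
    and lim: "((\<lambda>(p, x). f p x) \<longlongrightarrow> l)
      (inf (filtercomap fst sequentially) (filtercomap (\<lambda>(p, x). D p x) (nhds 0)))"
  shows "(\<lambda>p. \<integral>x. f p x \<partial>M p) \<longlonglongrightarrow> l"
proof (rule tendstoI)
  fix \<epsilon> :: real assume \<epsilon>: "0 < \<epsilon>"
  have "eventually (\<lambda>(p, x). \<bar>f p x - l\<bar> < \<epsilon> / 2)
     (inf (filtercomap fst sequentially) (filtercomap (\<lambda>(p, x). D p x) (nhds 0)))"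
    using tendstoD[OF lim, of "\<epsilon> / 2"] \<epsilon> unfolding dist_real_def case_prod_beta by simp
  then obtain P Q where PQ: "eventually P sequentially" "eventually Q (nhds (0::real))"
    "\<And>p x. P p \<Longrightarrow> Q (D p x) \<Longrightarrow> \<bar>f p x - l\<bar> < \<epsilon> / 2"
    unfolding eventually_inf eventually_filtercomap by (fastforce)
  from PQ(2) obtain \<delta> where \<delta>: "0 < \<delta>" "\<And>d. \<bar>d\<bar> < \<delta> \<Longrightarrow> Q d"
    by (auto simp: eventually_nhds_metric dist_real_def)
  have "(\<lambda>p. (1 + \<bar>l\<bar>) / \<delta> * e p) \<longlonglongrightarrow> (1 + \<bar>l\<bar>) / \<delta> * 0"
    by (intro tendsto_intros e)
  then have "eventually (\<lambda>p. (1 + \<bar>l\<bar>) / \<delta> * e p < \<epsilon> / 2) sequentially"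
    using \<epsilon> by (intro order_tendstoD(2)) auto
  with PQ(1) show "eventually (\<lambda>p. dist (\<integral>x. f p x \<partial>M p) l < \<epsilon>) sequentially"
  proof eventually_elim
    case (elim p)
    interpret prob_space "M p" by fact
    have fi: "integrable (M p) (f p)"
      by (rule integrable_const_bound[where B=1]) (use f in auto)
    have "(\<integral>\<^sup>+x. ennreal (D p x) \<partial>M p) < \<infinity>"
      using le_less_trans[OF e(1)[of p] ennreal_less_top] by simp
    then have Di: "integrable (M p) (D p)"
      using D by (intro integrableI_nonneg) auto
    have "ennreal (\<integral>x. D p x \<partial>M p) \<le> ennreal (e p)"
      using e(1)[of p] nn_integral_eq_integral[OF Di] D by simp
    then have De: "(\<integral>x. D p x \<partial>M p) \<le> e p"
      using e(3) by simp
    \<comment> \<open>Where \<open>D p x \<ge> \<delta>\<close>, the crude bound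
      \<open>1 + \<bar>l\<bar>\<close> is multiplied by \<open>D p x / \<delta> \<ge> 1\<close>. One
      pointwise inequality thus replaces a splitting of the integral.\<close>
    have bound: "\<bar>f p x - l\<bar> \<le> \<epsilon> / 2 + (1 + \<bar>l\<bar>) / \<delta> * D p x" for x
    proof (cases "D p x < \<delta>")
      case True
      then have "\<bar>f p x - l\<bar> < \<epsilon> / 2" using D[of p x] elim(1) \<delta>(2) PQ(3) by auto
      moreover have "0 \<le> (1 + \<bar>l\<bar>) / \<delta> * D p x" using D \<delta>(1) by simp
      ultimately show ?thesis by simp
    next
      case False
      have "\<bar>f p x - l\<bar> \<le> 1 + \<bar>l\<bar>" using f[of p x] by auto
      also have "\<dots> = (1 + \<bar>l\<bar>) / \<delta> * \<delta>" using \<delta>(1) by simp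
      also have "\<dots> \<le> (1 + \<bar>l\<bar>) / \<delta> * D p x"
        using False \<delta>(1) by (intro mult_left_mono) auto
      finally show ?thesis using \<epsilon> by simp
    qed
    have "\<bar>(\<integral>x. f p x \<partial>M p) - l\<bar> = \<bar>\<integral>x. f p x - l \<partial>M p\<bar>"
      using fi by (simp add: prob_space)
    also have "\<dots> \<le> (\<integral>x. \<bar>f p x - l\<bar> \<partial>M p)"
      by (rule integral_abs_bound)
    also have "\<dots> \<le> (\<integral>x. \<epsilon> / 2 + (1 + \<bar>l\<bar>) / \<delta> * D p x \<partial>M p)"
      using fi Di bound by (intro integral_mono) auto
    also have "\<dots> = \<epsilon> / 2 + (1 + \<bar>l\<bar>) / \<delta> * (\<integral>x. D p x \<partial>M p)"
      using Di by (simp add: prob_space)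
    also have "\<dots> \<le> \<epsilon> / 2 + (1 + \<bar>l\<bar>) / \<delta> * e p"
      using De \<delta>(1) by (intro add_left_mono mult_left_mono) auto
    also have "\<dots> < \<epsilon>" using elim(2) by linarith
    finally show ?case by (simp add: dist_real_def)
  qed
qed

text \<open>Each statistic enters \<open>deviation\<close> as one square among nonnegative terms;
  this extracts its limit.\<close>

lemma tendsto_zero_of_square_le:
  fixes h g :: "'a \<Rightarrow> real"
  assumes "(g \<longlongrightarrow> 0) F" "\<And>x. (h x)\<^sup>2 \<le> g x"
  shows "(h \<longlongrightarrow> 0) F"
proof -
  have "((\<lambda>x. sqrt (g x)) \<longlongrightarrow> sqrt 0) F" by (intro tendsto_intros assms)
  then show ?thesis
    using assms(2) by (intro Lim_null_comparison[of h "\<lambda>x. sqrt (g x)"] always_eventually) (auto simp: real_le_rsqrt)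
qed

lemma Phi_eq_cdf: "Phi = cdf (density lborel std_normal_density)"
  by (auto simp: Phi_def cdf_def)

text \<open>A distribution function is continuous where its law has no atom, and a law with a
  Lebesgue density has none.\<close>

lemma isCont_Phi: "isCont Phi x"
proof -
  interpret real_distribution "density lborel std_normal_density" by (rule real_dist_normal_dist)
  have "emeasure (density lborel std_normal_density) {x} = 0"
    by (subst emeasure_density) (auto intro!: nn_integral_0_iff_AE[THEN iffD2] AE_I[where N="{x}"] split: split_indicator)
  then show ?thesis
    unfolding Phi_eq_cdf isCont_cdf by (simp add: measure_def)
qed

lemma Phi_bounds: "0 \<le> Phi x \<and> Phi x \<le> 1"
proof -
  interpret real_distribution "density lborel std_normal_density" by (rule real_dist_normal_dist)
  show ?thesis by (simp add: Phi_def)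
qed

lemma measurable_Phi [measurable]: "Phi \<in> borel_measurable borel"
  by (intro borel_measurable_continuous_onI continuous_at_imp_continuous_on) (auto intro: isCont_Phi)

section \<open>The estimator in whitened coordinates\<close>

text \<open>A single scalar discrepancy controlling all five statistics. The squared norms are
  centred at their exact means \<open>p * s^2\<close> and \<open>p * t^2\<close> rather than at the
  limits, so that its expectation has a closed form and the convergence of these means remains a
  deterministic matter.\<close>

definition deviation :: "nat \<Rightarrow> real \<Rightarrow> real \<Rightarrow> (nat \<Rightarrow> real) \<Rightarrow> (nat \<Rightarrow> real) \<times> (nat \<Rightarrow> real) \<Rightarrow> real" where
  "deviation p s t w y = (ip p (fst y) (fst y) - real p * s\<^sup>2)\<^sup>2 + (ip p (snd y) (snd y) - real p * t\<^sup>2)\<^sup>2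
     + (ip p w (fst y))\<^sup>2 + (ip p w (snd y))\<^sup>2 + (ip p (fst y) (snd y))\<^sup>2"

lemma measurable_deviation: "deviation p s t w \<in> borel_measurable (Bvec p \<Otimes>\<^sub>M Bvec p)"
  unfolding deviation_def[abs_def] by measurable

lemma nn_integral_deviation:
  assumes s: "0 < s" and t: "0 < t"
  shows "(\<integral>\<^sup>+y. ennreal (deviation p s t w y) \<partial>(gauss p s \<Otimes>\<^sub>M gauss p t))
    = ennreal (2 * (real p * s\<^sup>2) * s\<^sup>2 + 2 * (real p * t\<^sup>2) * t\<^sup>2 + s\<^sup>2 * ip p w w + t\<^sup>2 * ip p w w
        + t\<^sup>2 * (real p * s\<^sup>2))"
proof -
  interpret S: prob_space "gauss p s" using s by (rule prob_space_gauss)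
  interpret T: prob_space "gauss p t" using t by (rule prob_space_gauss)
  have sets [measurable_cong]: "sets (gauss p s \<Otimes>\<^sub>M gauss p t) = sets (Bvec p \<Otimes>\<^sub>M Bvec p)"
    by (intro sets_pair_measure_cong) auto
  have pair: "(\<integral>\<^sup>+y. h y \<partial>(gauss p s \<Otimes>\<^sub>M gauss p t)) = (\<integral>\<^sup>+x. \<integral>\<^sup>+y. h (x, y) \<partial>gauss p t \<partial>gauss p s)"
    if "h \<in> borel_measurable (Bvec p \<Otimes>\<^sub>M Bvec p)" for h
    using that by (intro T.nn_integral_fst[symmetric]) (simp cong: measurable_cong_sets add: sets)
  have const: "emeasure (gauss p s) (space (Bvec p)) = 1" "emeasure (gauss p t) (space (Bvec p)) = 1"
    using S.emeasure_space_1 T.emeasure_space_1 by simp_all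
  have w: "0 \<le> ip p w w" by (simp add: ip_def sum_nonneg)
  have 1: "(\<integral>\<^sup>+y. ennreal ((ip p (fst y) (fst y) - real p * s\<^sup>2)\<^sup>2) \<partial>(gauss p s \<Otimes>\<^sub>M gauss p t))
      = ennreal (2 * (real p * s\<^sup>2) * s\<^sup>2)"
    by (subst pair) (auto simp: const nn_integral_gauss_norm_sq_deviation[OF s])
  have 2: "(\<integral>\<^sup>+y. ennreal ((ip p (snd y) (snd y) - real p * t\<^sup>2)\<^sup>2) \<partial>(gauss p s \<Otimes>\<^sub>M gauss p t))
      = ennreal (2 * (real p * t\<^sup>2) * t\<^sup>2)"
    by (subst pair) (auto simp: const nn_integral_gauss_norm_sq_deviation[OF t])
  have 3: "(\<integral>\<^sup>+y. ennreal ((ip p w (fst y))\<^sup>2) \<partial>(gauss p s \<Otimes>\<^sub>M gauss p t)) = ennreal (s\<^sup>2 * ip p w w)"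
    by (subst pair) (auto simp: const nn_integral_gauss_ip_sq[OF s])
  have 4: "(\<integral>\<^sup>+y. ennreal ((ip p w (snd y))\<^sup>2) \<partial>(gauss p s \<Otimes>\<^sub>M gauss p t)) = ennreal (t\<^sup>2 * ip p w w)"
    by (subst pair) (auto simp: const nn_integral_gauss_ip_sq[OF t])
  have 5: "(\<integral>\<^sup>+y. ennreal ((ip p (fst y) (snd y))\<^sup>2) \<partial>(gauss p s \<Otimes>\<^sub>M gauss p t)) = ennreal (t\<^sup>2 * (real p * s\<^sup>2))"
    by (subst pair) (auto simp: nn_integral_gauss_cross_sq[OF s t])
  have "(\<integral>\<^sup>+y. ennreal (deviation p s t w y) \<partial>(gauss p s \<Otimes>\<^sub>M gauss p t))
    = (\<integral>\<^sup>+y. ennreal ((ip p (fst y) (fst y) - real p * s\<^sup>2)\<^sup>2) + ennreal ((ip p (snd y) (snd y) - real p * t\<^sup>2)\<^sup>2)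
      + ennreal ((ip p w (fst y))\<^sup>2) + ennreal ((ip p w (snd y))\<^sup>2) + ennreal ((ip p (fst y) (snd y))\<^sup>2)
      \<partial>(gauss p s \<Otimes>\<^sub>M gauss p t))"
    by (intro nn_integral_cong) (simp add: deviation_def)
  also have "\<dots> = ennreal (2 * (real p * s\<^sup>2) * s\<^sup>2) + ennreal (2 * (real p * t\<^sup>2) * t\<^sup>2)
      + ennreal (s\<^sup>2 * ip p w w) + ennreal (t\<^sup>2 * ip p w w) + ennreal (t\<^sup>2 * (real p * s\<^sup>2))"
    by (simp add: nn_integral_add 1 2 3 4 5)
  finally show ?thesis using w by simp
qed

definition whitening :: "nat \<Rightarrow> real mat \<Rightarrow> (nat \<Rightarrow> nat \<Rightarrow> real) \<Rightarrow> real mat \<Rightarrow> bool" where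
  "whitening p C L K \<longleftrightarrow> K \<in> carrier_mat p p \<and> K * mat p p (\<lambda>(i, j). L i j) = 1\<^sub>m p \<and>
    (\<forall>u \<in> carrier_vec p. \<forall>v \<in> carrier_vec p. qform C u v = scalar_prod (K *\<^sub>v u) (K *\<^sub>v v))"

lemma bayes_err_class_bounds: "0 \<le> bayes_err_class i Sig n0 n1 nu0 nu1 m0 m1 c x y \<and>
    bayes_err_class i Sig n0 n1 nu0 nu1 m0 m1 c x y \<le> 1"
  unfolding bayes_err_class_def Let_def by (rule Phi_bounds)

lemma measurable_bayes_err_class:
  assumes wh: "whitening p Sig L K" and m: "m0 \<in> carrier_vec p" "m1 \<in> carrier_vec p"
  shows "(\<lambda>(x, y). bayes_err_class i Sig n0 n1 nu0 nu1 m0 m1 c (vec p x) (vec p y))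
      \<in> borel_measurable (Bvec p \<Otimes>\<^sub>M Bvec p)"
proof -
  have K: "K \<in> carrier_mat p p"
    and q: "\<And>u v. u \<in> carrier_vec p \<Longrightarrow> v \<in> carrier_vec p \<Longrightarrow> qform Sig u v = scalar_prod (K *\<^sub>v u) (K *\<^sub>v v)"
    using wh by (auto simp: whitening_def)
  have qm: "(\<lambda>z. qform Sig (u z) (v z)) \<in> borel_measurable (Bvec p \<Otimes>\<^sub>M Bvec p)"
    if "\<And>z. u z \<in> carrier_vec p" "\<And>z. v z \<in> carrier_vec p"
      "\<And>k. k < p \<Longrightarrow> (\<lambda>z. vec_index (u z) k) \<in> borel_measurable (Bvec p \<Otimes>\<^sub>M Bvec p)"
      "\<And>k. k < p \<Longrightarrow> (\<lambda>z. vec_index (v z) k) \<in> borel_measurable (Bvec p \<Otimes>\<^sub>M Bvec p)" for u v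
    using measurable_mult_mat_vec[OF K that(3,4) that(1,2)] q that(1,2) by simp
  let ?x = "\<lambda>z::(nat \<Rightarrow> real) \<times> (nat \<Rightarrow> real). vec p (fst z)" and ?y = "\<lambda>z::(nat \<Rightarrow> real) \<times> (nat \<Rightarrow> real). vec p (snd z)"
  have d [measurable]: "(\<lambda>z. qform Sig (?x z - ?y z) (?x z - ?y z)) \<in> borel_measurable (Bvec p \<Otimes>\<^sub>M Bvec p)"
    by (intro qm) auto
  have 0 [measurable]: "(\<lambda>z. qform Sig (a \<cdot>\<^sub>v (b \<cdot>\<^sub>v ?x z + e \<cdot>\<^sub>v m0) - (1/2) \<cdot>\<^sub>v (?x z + ?y z)) (?x z - ?y z))
      \<in> borel_measurable (Bvec p \<Otimes>\<^sub>M Bvec p)" for a b e :: real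
    using m by (intro qm) auto
  have 1 [measurable]: "(\<lambda>z. qform Sig (a \<cdot>\<^sub>v (b \<cdot>\<^sub>v ?y z + e \<cdot>\<^sub>v m1) - (1/2) \<cdot>\<^sub>v (?x z + ?y z)) (?x z - ?y z))
      \<in> borel_measurable (Bvec p \<Otimes>\<^sub>M Bvec p)" for a b e :: real
    using m by (intro qm) auto
  show ?thesis
    unfolding bayes_err_class_def Let_def case_prod_beta
    by (cases "i = 0"; simp only: refl if_True if_False;
        intro measurable_compose[OF _ measurable_Phi] borel_measurable_times borel_measurable_divide
          borel_measurable_add borel_measurable_uminus borel_measurable_const
          measurable_compose[OF _ borel_measurable_sqrt] 0 1 d)
qed

context
  fixes p :: nat and Sig K :: "real mat" and L :: "nat \<Rightarrow> nat \<Rightarrow> real" and m0 m1 :: "real vec"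
  assumes wh: "whitening p Sig L K" and m: "m0 \<in> carrier_vec p" "m1 \<in> carrier_vec p"
begin

abbreviation (input) "whitened_diff \<equiv> vec_index (K *\<^sub>v (m0 - m1))"

lemma ip_whitened_diff: "ip p whitened_diff whitened_diff = qform Sig (m0 - m1) (m0 - m1)"
proof -
  have "qform Sig (m0 - m1) (m0 - m1) = scalar_prod (K *\<^sub>v (m0 - m1)) (K *\<^sub>v (m0 - m1))"
    using wh m by (simp add: whitening_def)
  moreover have "dim_vec (K *\<^sub>v (m0 - m1)) = p" using wh by (auto simp: whitening_def)
  ultimately show ?thesis by (simp only: ip_def scalar_prod_def atLeast0LessThan)
qed

text \<open>Whitening sends each sample mean to \<open>K m + y\<close>, so their difference becomes
  \<open>w + y0 - y1\<close> with \<open>w\<close> the whitened difference of prior means. Expanding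
  the scalar products leaves only the listed inner products.\<close>

lemma bayes_err_class_whitened:
  fixes n0 n1 :: nat and nu0 nu1 c :: real and y0 y1 :: "nat \<Rightarrow> real"
  assumes pos: "0 < real n0 + nu0" "0 < real n1 + nu1"
  defines "x0 \<equiv> vec p (aff p (vec_index m0) L y0)" and "x1 \<equiv> vec p (aff p (vec_index m1) L y1)"
    and "W \<equiv> ip p whitened_diff whitened_diff" and "A0 \<equiv> ip p y0 y0" and "A1 \<equiv> ip p y1 y1"
    and "B0 \<equiv> ip p whitened_diff y0" and "B1 \<equiv> ip p whitened_diff y1" and "C \<equiv> ip p y0 y1"
    and "t0 \<equiv> real n0 / (real n0 + nu0)" and "t1 \<equiv> real n1 / (real n1 + nu1)"
  shows "bayes_err_class 0 Sig n0 n1 nu0 nu1 m0 m1 c x0 x1 =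
      Phi ((- (W / 2 + (B0 - B1) / 2 + (t0 - 1 / 2) * (B0 + A0 - C) - (B1 + C - A1) / 2) + c)
        / sqrt (W + A0 + A1 + 2 * B0 - 2 * B1 - 2 * C) * sqrt ((real n0 + nu0) / (real n0 + nu0 + 1)))" (is ?th0)
    and "bayes_err_class 1 Sig n0 n1 nu0 nu1 m0 m1 c x0 x1 =
      Phi (- ((- (- W / 2 - (B0 - B1) / 2 + (t1 - 1 / 2) * (B1 + C - A1) - (B0 + A0 - C) / 2) + c)
        / sqrt (W + A0 + A1 + 2 * B0 - 2 * B1 - 2 * C)) * sqrt ((real n1 + nu1) / (real n1 + nu1 + 1)))" (is ?th1)
proof -
  let ?L = "mat p p (\<lambda>(i, j). L i j)"
  have K: "K \<in> carrier_mat p p" "K * ?L = 1\<^sub>m p"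
    and q: "\<And>u v. u \<in> carrier_vec p \<Longrightarrow> v \<in> carrier_vec p \<Longrightarrow> qform Sig u v = scalar_prod (K *\<^sub>v u) (K *\<^sub>v v)"
    using wh by (auto simp: whitening_def)
  have Kc: "K *\<^sub>v u \<in> carrier_vec p" for u
    by (intro carrier_vecI) (use K(1) in auto)
  define a b where "a = vec_index (K *\<^sub>v m0)" and "b = vec_index (K *\<^sub>v m1)"
  let ?w = whitened_diff
  have Lc: "?L *\<^sub>v vec p y \<in> carrier_vec p" for y by (simp add: mult_mat_vec_carrier[of _ p p])
  have x [simp]: "x0 \<in> carrier_vec p" "x1 \<in> carrier_vec p" by (simp_all add: x0_def x1_def)
  have Kx: "K *\<^sub>v x0 = K *\<^sub>v m0 + vec p y0" "K *\<^sub>v x1 = K *\<^sub>v m1 + vec p y1"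
    unfolding x0_def x1_def tri_factor_mult_vec(1)[OF K m(1)] tri_factor_mult_vec(1)[OF K m(2)]
    using K m Lc by (simp_all add: mult_add_distrib_mat_vec[of K p p] tri_factor_mult_vec(2)[OF K m(1)])
  have w: "?w k = a k - b k" if "k < p" for k
    using that K(1) m Kc by (simp add: mult_minus_distrib_mat_vec[OF K(1)] a_def b_def)
  have d: "vec_index (K *\<^sub>v (x0 - x1)) k = ?w k + y0 k - y1 k" if "k < p" for k
    using that K(1) Kc[of m0] Kc[of m1] m w[OF that]
    by (simp add: mult_minus_distrib_mat_vec[OF K(1)] Kx a_def b_def)
  have comb: "vec_index (K *\<^sub>v (r \<cdot>\<^sub>v (n \<cdot>\<^sub>v xi + nu \<cdot>\<^sub>v mi) - (1 / 2) \<cdot>\<^sub>v (x0 + x1))) k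
      = r * (n * vec_index (K *\<^sub>v xi) k + nu * vec_index (K *\<^sub>v mi) k) - (1 / 2) * (a k + y0 k + b k + y1 k)"
    if "k < p" "xi \<in> carrier_vec p" "mi \<in> carrier_vec p" for r n nu :: real and xi mi k
    using that K(1) Kc[of m0] Kc[of m1] Kc[of xi] Kc[of mi]
    by (simp add: mult_minus_distrib_mat_vec[OF K(1)] mult_add_distrib_mat_vec[OF K(1)] mult_mat_vec[OF K(1)]
        Kx a_def b_def)
  \<comment> \<open>The posterior mean shrinks the sample mean towards \<open>m0\<close> with weight
    \<open>t0\<close>, so it whitens to \<open>K m0 + t0 y0\<close>; subtracting the midpoint leaves
    half of \<open>w\<close> and the stated noise. \<open>s1\<close> is the mirror image.\<close>
  have s0: "vec_index (K *\<^sub>v ((1 / (real n0 + nu0)) \<cdot>\<^sub>v (real n0 \<cdot>\<^sub>v x0 + nu0 \<cdot>\<^sub>v m0) - (1 / 2) \<cdot>\<^sub>v (x0 + x1))) k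
      = ?w k / 2 + (t0 - 1 / 2) * y0 k - y1 k / 2" if "k < p" for k
    using that pos m w[OF that] Kc[of m0] by (simp add: comb Kx t0_def a_def[symmetric])
      (simp add: field_simps)
  have s1: "vec_index (K *\<^sub>v ((1 / (real n1 + nu1)) \<cdot>\<^sub>v (real n1 \<cdot>\<^sub>v x1 + nu1 \<cdot>\<^sub>v m1) - (1 / 2) \<cdot>\<^sub>v (x0 + x1))) k
      = - ?w k / 2 + (t1 - 1 / 2) * y1 k - y0 k / 2" if "k < p" for k
    using that pos m w[OF that] Kc[of m1] by (simp add: comb Kx t1_def b_def[symmetric])
      (simp add: field_simps)
  have qsum: "qform Sig u v = (\<Sum>k<p. vec_index (K *\<^sub>v u) k * vec_index (K *\<^sub>v v) k)"
    if "u \<in> carrier_vec p" "v \<in> carrier_vec p" for u v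
    using that K(1) by (simp add: q scalar_prod_def atLeast0LessThan)
  note ipd = W_def A0_def A1_def B0_def B1_def C_def ip_def
  have Q: "qform Sig (x0 - x1) (x0 - x1) = W + A0 + A1 + 2 * B0 - 2 * B1 - 2 * C"
  proof -
    have "qform Sig (x0 - x1) (x0 - x1) = (\<Sum>k<p. (?w k + y0 k - y1 k) * (?w k + y0 k - y1 k))"
      by (subst qsum) (auto simp: d intro!: sum.cong)
    also have "\<dots> = W + A0 + A1 + 2 * B0 - 2 * B1 - 2 * C"
      unfolding ipd sum_distrib_left sum.distrib[symmetric] sum_subtractf[symmetric]
      by (intro sum.cong) (auto simp: algebra_simps)
    finally show ?thesis .
  qed
  have R0: "qform Sig ((1 / (real n0 + nu0)) \<cdot>\<^sub>v (real n0 \<cdot>\<^sub>v x0 + nu0 \<cdot>\<^sub>v m0) - (1 / 2) \<cdot>\<^sub>v (x0 + x1)) (x0 - x1)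
    = W / 2 + (B0 - B1) / 2 + (t0 - 1 / 2) * (B0 + A0 - C) - (B1 + C - A1) / 2" (is "qform Sig ?u _ = _")
  proof -
    have "qform Sig ?u (x0 - x1) = (\<Sum>k<p. (?w k / 2 + (t0 - 1 / 2) * y0 k - y1 k / 2) * (?w k + y0 k - y1 k))"
      using m by (subst qsum) (auto simp: d s0 intro!: sum.cong)
    also have "\<dots> = W / 2 + (B0 - B1) / 2 + (t0 - 1 / 2) * (B0 + A0 - C) - (B1 + C - A1) / 2"
      unfolding ipd sum_distrib_left sum.distrib[symmetric] sum_subtractf[symmetric] sum_divide_distrib
      by (intro sum.cong) (auto simp: field_simps)
    finally show ?thesis .
  qed
  have R1: "qform Sig ((1 / (real n1 + nu1)) \<cdot>\<^sub>v (real n1 \<cdot>\<^sub>v x1 + nu1 \<cdot>\<^sub>v m1) - (1 / 2) \<cdot>\<^sub>v (x0 + x1)) (x0 - x1)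
    = - W / 2 - (B0 - B1) / 2 + (t1 - 1 / 2) * (B1 + C - A1) - (B0 + A0 - C) / 2" (is "qform Sig ?u _ = _")
  proof -
    have "qform Sig ?u (x0 - x1) = (\<Sum>k<p. (- ?w k / 2 + (t1 - 1 / 2) * y1 k - y0 k / 2) * (?w k + y0 k - y1 k))"
      using m by (subst qsum) (auto simp: d s1 intro!: sum.cong)
    also have "\<dots> = - W / 2 - (B0 - B1) / 2 + (t1 - 1 / 2) * (B1 + C - A1) - (B0 + A0 - C) / 2"
      unfolding ipd sum_distrib_left sum.distrib[symmetric] sum_subtractf[symmetric] sum_divide_distrib
        sum_negf[symmetric]
      by (intro sum.cong) (auto simp: field_simps)
    finally show ?thesis .
  qed
  show ?th0
    unfolding bayes_err_class_def Let_def by (simp only: refl if_True R0 Q power_0 mult_1)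
  show ?th1
    unfolding bayes_err_class_def Let_def
    by (simp only: one_neq_zero if_False R1 Q power_one_right mult_minus_left mult_1)
qed

end

section \<open>The limit\<close>

text \<open>The term \<open>J / g\<close> is the contribution of the prior, \<open>p / nu\<close>,
  obtained as the quotient of \<open>p / n\<close> by \<open>nu / n\<close>. The limit
  \<open>1 / (1 + g)\<close> is the asymptotic weight of the sample mean in the posterior
  mean.\<close>

lemma sample_size_limits:
  fixes n :: "nat \<Rightarrow> nat" and nu :: "nat \<Rightarrow> real"
  assumes pos: "\<And>p. 0 < n p" "\<And>p. 0 < nu p"
    and inf: "filterlim n at_top sequentially" "filterlim nu at_top sequentially"
    and J: "(\<lambda>p. real p / real (n p)) \<longlonglongrightarrow> J" and g: "(\<lambda>p. nu p / real (n p)) \<longlonglongrightarrow> g" "0 < g"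
  shows "(\<lambda>p. 1 / nu p + 1 / real (n p)) \<longlonglongrightarrow> 0"
    and "(\<lambda>p. real p * (1 / nu p + 1 / real (n p))) \<longlonglongrightarrow> J + J / g"
    and "(\<lambda>p. real (n p) / (real (n p) + nu p)) \<longlonglongrightarrow> 1 / (1 + g)"
    and "(\<lambda>p. sqrt ((real (n p) + nu p) / (real (n p) + nu p + 1))) \<longlonglongrightarrow> 1"
proof -
  have rn: "filterlim (\<lambda>p. real (n p)) at_top sequentially"
    using filterlim_compose[OF filterlim_real_sequentially inf(1)] .
  have i: "(\<lambda>p. 1 / real (n p)) \<longlonglongrightarrow> 0" "(\<lambda>p. 1 / nu p) \<longlonglongrightarrow> 0"
    using tendsto_inverse_0_at_top[OF rn] tendsto_inverse_0_at_top[OF inf(2)] by (simp_all add: inverse_eq_divide)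
  show "(\<lambda>p. 1 / nu p + 1 / real (n p)) \<longlonglongrightarrow> 0"
    using tendsto_add[OF i(2,1)] by simp
  have "(\<lambda>p. real p / real (n p) + (real p / real (n p)) / (nu p / real (n p))) \<longlonglongrightarrow> J + J / g"
    using g(2) by (intro tendsto_intros J g(1)) auto
  moreover have "real p / real (n p) + (real p / real (n p)) / (nu p / real (n p)) = real p * (1 / nu p + 1 / real (n p))" for p
    using pos[of p] by (simp add: field_simps)
  ultimately show "(\<lambda>p. real p * (1 / nu p + 1 / real (n p))) \<longlonglongrightarrow> J + J / g" by simp
  have "(\<lambda>p. 1 / (1 + nu p / real (n p))) \<longlonglongrightarrow> 1 / (1 + g)"
    using g(2) by (intro tendsto_intros g(1)) auto
  moreover have "1 / (1 + nu p / real (n p)) = real (n p) / (real (n p) + nu p)" for p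
    using pos[of p] by (simp add: field_simps)
  ultimately show "(\<lambda>p. real (n p) / (real (n p) + nu p)) \<longlonglongrightarrow> 1 / (1 + g)" by simp
  have "filterlim (\<lambda>p. real (n p) + nu p + 1) at_top sequentially"
    using filterlim_at_top_add_at_top[OF rn inf(2)]
    by (intro filterlim_tendsto_add_at_top[OF tendsto_const, of _ _ 1, unfolded add.commute[of 1]])
  then have "(\<lambda>p. sqrt (1 - inverse (real (n p) + nu p + 1))) \<longlonglongrightarrow> sqrt (1 - 0)"
    by (intro tendsto_intros tendsto_inverse_0_at_top)
  moreover have "1 - inverse (real (n p) + nu p + 1) = (real (n p) + nu p) / (real (n p) + nu p + 1)" for p
    using pos[of p] by (simp add: field_simps)
  ultimately show "(\<lambda>p. sqrt ((real (n p) + nu p) / (real (n p) + nu p + 1))) \<longlonglongrightarrow> 1" by simp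
qed

theorem theorem2:
  fixes Sig :: "nat \<Rightarrow> real mat"
    and n0 n1 :: "nat \<Rightarrow> nat"
    and nu0 nu1 :: "nat \<Rightarrow> real"
    and m0 m1 :: "nat \<Rightarrow> real vec"
    and a0 J0 J1 g0 g1 Dbar2 :: real
  assumes a0: "0 < a0" "a0 < 1"
    and Sig: "\<And>p. spd_mat p (Sig p)"
    and m_dim: "\<And>p. m0 p \<in> carrier_vec p" "\<And>p. m1 p \<in> carrier_vec p"
    and n_pos: "\<And>p. n0 p > 0" "\<And>p. n1 p > 0"
    and nu_pos: "\<And>p. nu0 p > 0" "\<And>p. nu1 p > 0"
    and n_inf: "filterlim n0 at_top sequentially" "filterlim n1 at_top sequentially"
    and nu_inf: "filterlim nu0 at_top sequentially" "filterlim nu1 at_top sequentially"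
    and J: "(\<lambda>p. real p / real (n0 p)) \<longlonglongrightarrow> J0" "(\<lambda>p. real p / real (n1 p)) \<longlonglongrightarrow> J1"
      "J0 \<ge> 0" "J1 \<ge> 0"
    and g: "(\<lambda>p. nu0 p / real (n0 p)) \<longlonglongrightarrow> g0" "(\<lambda>p. nu1 p / real (n1 p)) \<longlonglongrightarrow> g1"
      "g0 > 0" "g1 > 0"
    and m_conv: "convergent (\<lambda>p. qform (Sig p) (m0 p) (m0 p))"
      "convergent (\<lambda>p. qform (Sig p) (m0 p) (m1 p))"
      "convergent (\<lambda>p. qform (Sig p) (m1 p) (m0 p))"
      "convergent (\<lambda>p. qform (Sig p) (m1 p) (m1 p))"
    and Dbar: "(\<lambda>p. qform (Sig p) (m0 p - m1 p) (m0 p - m1 p)) \<longlonglongrightarrow> Dbar2"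
    and F_pos: "Dbar2 + J0 + J1 + J0 / g0 + J1 / g1 > 0"
  shows
    "let c = ln ((1 - a0) / a0);
         H0 = (1 / 2) * (Dbar2 + J1 - J0 + J0 / g0 + J1 / g1);
         H1 = - (1 / 2) * (Dbar2 + J0 - J1 + J0 / g0 + J1 / g1);
         F = Dbar2 + J0 + J1 + J0 / g0 + J1 / g1
     in (\<forall>i::nat \<in> {0, 1}.
           (\<lambda>p. model_expect p (Sig p) (n0 p) (n1 p) (nu0 p) (nu1 p) (m0 p) (m1 p)
                   (bayes_err_class i (Sig p) (n0 p) (n1 p) (nu0 p) (nu1 p) (m0 p) (m1 p) c))
           \<longlonglongrightarrow> Phi ((-1) ^ i * ((- (if i = 0 then H0 else H1) + c) / sqrt F))) \<and>
        (\<lambda>p. model_expect p (Sig p) (n0 p) (n1 p) (nu0 p) (nu1 p) (m0 p) (m1 p)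
                (bayes_err a0 (Sig p) (n0 p) (n1 p) (nu0 p) (nu1 p) (m0 p) (m1 p) c))
        \<longlonglongrightarrow> a0 * Phi ((- H0 + c) / sqrt F) + (1 - a0) * Phi ((H1 - c) / sqrt F)"
proof -
  define c where "c = ln ((1 - a0) / a0)"
  define H0 where "H0 = (1 / 2) * (Dbar2 + J1 - J0 + J0 / g0 + J1 / g1)"
  define H1 where "H1 = - (1 / 2) * (Dbar2 + J0 - J1 + J0 / g0 + J1 / g1)"
  define F where "F = Dbar2 + J0 + J1 + J0 / g0 + J1 / g1"
  have "\<forall>p. \<exists>L. tri_factor p (Sig p) L" using spd_tri_factor[OF Sig] by metis
  then obtain L where tf: "\<And>p. tri_factor p (Sig p) (L p)" by metis
  have "\<forall>p. \<exists>K. whitening p (Sig p) (L p) K"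
    using tri_factor_whitening[OF tf] unfolding whitening_def by metis
  then obtain K where wh: "\<And>p. whitening p (Sig p) (L p) (K p)" by metis
  define w where "w p = vec_index (K p *\<^sub>v (m0 p - m1 p))" for p
  define s0 s1 where "s0 p = sqrt (1 / nu0 p + 1 / real (n0 p))" and "s1 p = sqrt (1 / nu1 p + 1 / real (n1 p))" for p
  have s_pos: "0 < s0 p" "0 < s1 p" for p
    using n_pos[of p] nu_pos[of p] by (simp_all add: s0_def s1_def add_pos_pos)
  have s_sq: "(s0 p)\<^sup>2 = 1 / nu0 p + 1 / real (n0 p)" "(s1 p)\<^sup>2 = 1 / nu1 p + 1 / real (n1 p)" for p
    using n_pos[of p] nu_pos[of p] by (simp_all add: s0_def s1_def less_imp_le)
  note lim0 = sample_size_limits[OF n_pos(1) nu_pos(1) n_inf(1) nu_inf(1) J(1) g(1) g(3), folded s_sq]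
  note lim1 = sample_size_limits[OF n_pos(2) nu_pos(2) n_inf(2) nu_inf(2) J(2) g(2) g(4), folded s_sq]
  define W where "W p = ip p (w p) (w p)" for p
  have W_eq: "W p = qform (Sig p) (m0 p - m1 p) (m0 p - m1 p)" for p
    unfolding W_def w_def by (rule ip_whitened_diff[OF wh m_dim])
  have W_lim: "W \<longlonglongrightarrow> Dbar2" using Dbar by (simp add: W_eq[abs_def])
  define M where "M p = gauss p (s0 p) \<Otimes>\<^sub>M gauss p (s1 p)" for p
  define D where "D p = deviation p (s0 p) (s1 p) (w p)" for p
  \<comment> \<open>The exact mean of \<open>D p\<close>; each summand pairs a convergent factor
    with a vanishing variance.\<close>
  define e where "e p = 2 * (real p * (s0 p)\<^sup>2) * (s0 p)\<^sup>2 + 2 * (real p * (s1 p)\<^sup>2) * (s1 p)\<^sup>2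
    + (s0 p)\<^sup>2 * W p + (s1 p)\<^sup>2 * W p + (s1 p)\<^sup>2 * (real p * (s0 p)\<^sup>2)" for p
  have "e \<longlonglongrightarrow> 2 * (J0 + J0 / g0) * 0 + 2 * (J1 + J1 / g1) * 0 + 0 * Dbar2 + 0 * Dbar2 + 0 * (J0 + J0 / g0)"
    unfolding e_def[abs_def] by (intro tendsto_intros lim0 lim1 W_lim)
  then have e_lim: "e \<longlonglongrightarrow> 0" by simp
  have W_nonneg: "0 \<le> W p" for p by (simp add: W_def ip_def sum_nonneg)
  then have e_nonneg: "0 \<le> e p" for p by (simp add: e_def)
  \<comment> \<open>Pairs with large dimension and small discrepancy. Along this filter,
    deterministic sequences and random statistics combine by the ordinary limit rules, with no
    reference to a measure.\<close>
  define FF where "FF = inf (filtercomap fst sequentially) (filtercomap (\<lambda>(p, y). D p y) (nhds 0))"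
  have FF_seq: "((\<lambda>z. u (fst z)) \<longlongrightarrow> l) FF" if "u \<longlonglongrightarrow> l" for u :: "nat \<Rightarrow> real" and l
    unfolding FF_def
    by (rule filterlim_compose[OF that filterlim_mono[OF filterlim_filtercomap order_refl inf_le1]])
  have FF_D: "((\<lambda>(p, y). D p y) \<longlongrightarrow> 0) FF"
    unfolding FF_def
    by (rule filterlim_mono[OF filterlim_filtercomap order_refl inf_le2])
  have FF_small: "(h \<longlongrightarrow> 0) FF" if "\<And>p y. (h (p, y))\<^sup>2 \<le> D p y" for h :: "nat \<times> (nat \<Rightarrow> real) \<times> (nat \<Rightarrow> real) \<Rightarrow> real"
    by (rule tendsto_zero_of_square_le[OF FF_D]) (use that in auto)
  define A0 A1 B0 B1 C where "A0 z = ip (fst z) (fst (snd z)) (fst (snd z))"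
    and "A1 z = ip (fst z) (snd (snd z)) (snd (snd z))"
    and "B0 z = ip (fst z) (w (fst z)) (fst (snd z))" and "B1 z = ip (fst z) (w (fst z)) (snd (snd z))"
    and "C z = ip (fst z) (fst (snd z)) (snd (snd z))" for z
  \<comment> \<open>The mean is subtracted and added back because \<open>D\<close> controls only the
    deviation from it.\<close>
  have "((\<lambda>z. (A0 z - real (fst z) * (s0 (fst z))\<^sup>2) + real (fst z) * (s0 (fst z))\<^sup>2) \<longlongrightarrow> 0 + (J0 + J0 / g0)) FF"
    by (intro tendsto_add FF_small FF_seq lim0) (simp add: A0_def D_def deviation_def)
  then have A0: "(A0 \<longlongrightarrow> J0 + J0 / g0) FF" by simp
  have "((\<lambda>z. (A1 z - real (fst z) * (s1 (fst z))\<^sup>2) + real (fst z) * (s1 (fst z))\<^sup>2) \<longlongrightarrow> 0 + (J1 + J1 / g1)) FF"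
    by (intro tendsto_add FF_small FF_seq lim1) (simp add: A1_def D_def deviation_def)
  then have A1: "(A1 \<longlongrightarrow> J1 + J1 / g1) FF" by simp
  have B0: "(B0 \<longlongrightarrow> 0) FF" by (rule FF_small) (simp add: B0_def D_def deviation_def)
  have B1: "(B1 \<longlongrightarrow> 0) FF" by (rule FF_small) (simp add: B1_def D_def deviation_def)
  have C: "(C \<longlongrightarrow> 0) FF" by (rule FF_small) (simp add: C_def D_def deviation_def)
  define X where "X p b y = vec p (aff p (vec_index b) (L p) y)" for p b y
  let ?E = "\<lambda>p. model_expect p (Sig p) (n0 p) (n1 p) (nu0 p) (nu1 p) (m0 p) (m1 p)"
  \<comment> \<open>Reduces every limit of expectations to a limit of the integrand along
    \<open>FF\<close>, for an arbitrary measurable function with values in [0, 1].\<close>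
  have key: "(\<lambda>p. ?E p (f p)) \<longlonglongrightarrow> l"
    if f: "\<And>p x y. 0 \<le> f p x y \<and> f p x y \<le> 1"
      and f_meas: "\<And>p. (\<lambda>(x, y). f p (vec p x) (vec p y)) \<in> borel_measurable (Bvec p \<Otimes>\<^sub>M Bvec p)"
      and f_lim: "((\<lambda>z. f (fst z) (X (fst z) (m0 (fst z)) (fst (snd z))) (X (fst z) (m1 (fst z)) (snd (snd z)))) \<longlongrightarrow> l) FF"
    for f :: "nat \<Rightarrow> real vec \<Rightarrow> real vec \<Rightarrow> real" and l
  proof -
    define h where "h p y = f p (X p (m0 p) (fst y)) (X p (m1 p) (snd y))" for p y
    have sets [measurable_cong]: "sets (M p) = sets (Bvec p \<Otimes>\<^sub>M Bvec p)" for p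
      unfolding M_def by (intro sets_pair_measure_cong) auto
    have h_meas: "h p \<in> borel_measurable (M p)" for p
    proof -
      have "(\<lambda>y. (aff p (vec_index (m0 p)) (L p) (fst y), aff p (vec_index (m1 p)) (L p) (snd y)))
          \<in> measurable (M p) (Bvec p \<Otimes>\<^sub>M Bvec p)"
        by (intro measurable_Pair measurable_aff) measurable
      from measurable_compose[OF this f_meas[of p]] show ?thesis
        by (simp add: h_def[abs_def] X_def)
    qed
    have pr: "prob_space (M p)" for p
    proof -
      interpret S: prob_space "gauss p (s0 p)" using s_pos by (intro prob_space_gauss)
      interpret T: prob_space "gauss p (s1 p)" using s_pos by (intro prob_space_gauss)
      interpret P: pair_prob_space "gauss p (s0 p)" "gauss p (s1 p)" ..
      show ?thesis unfolding M_def by (rule P.prob_space_axioms)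
    qed
    have E_eq: "?E p (f p) = (\<integral>y. h p y \<partial>M p)" for p
    proof -
      interpret prob_space "M p" by (rule pr)
      interpret T: prob_space "gauss p (s1 p)" using s_pos by (intro prob_space_gauss)
      have h1: "0 \<le> h p y \<and> h p y \<le> 1" for y using f by (simp add: h_def)
      have "ennreal (?E p (f p)) = (\<integral>\<^sup>+y0. \<integral>\<^sup>+y1. ennreal (h p (y0, y1)) \<partial>gauss p (s1 p) \<partial>gauss p (s0 p))"
        using model_expect_gauss(1)[OF tf n_pos nu_pos m_dim f f_meas, of p]
        by (simp add: h_def X_def s0_def s1_def)
      also have "\<dots> = (\<integral>\<^sup>+y. ennreal (h p y) \<partial>M p)"
        using h_meas[of p] unfolding M_def by (intro T.nn_integral_fst) simp
      also have "\<dots> = ennreal (\<integral>y. h p y \<partial>M p)"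
        using h1 h_meas[of p] by (intro nn_integral_eq_integral integrable_const_bound[where B=1]) auto
      finally show ?thesis
        using model_expect_gauss(2)[OF tf n_pos nu_pos m_dim f f_meas, of p] h1
        by (simp add: Bochner_Integration.integral_nonneg)
    qed
    have "(\<lambda>p. \<integral>y. h p y \<partial>M p) \<longlonglongrightarrow> l"
    proof (rule expectation_tendsto_of_concentration[where D=D and e=e])
      show "D p \<in> borel_measurable (M p)" for p
        using measurable_deviation unfolding D_def by (simp cong: measurable_cong_sets add: sets)
      show "(\<integral>\<^sup>+y. ennreal (D p y) \<partial>M p) \<le> ennreal (e p)" for p
        unfolding M_def D_def nn_integral_deviation[OF s_pos] e_def W_def by simp
      show "0 \<le> D p y" for p y by (simp add: D_def deviation_def)
      show "((\<lambda>(p, y). h p y) \<longlongrightarrow> l) (inf (filtercomap fst sequentially) (filtercomap (\<lambda>(p, x). D p x) (nhds 0)))"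
        using f_lim unfolding FF_def h_def case_prod_beta .
      show "0 \<le> h p y \<and> h p y \<le> 1" for p y using f by (simp add: h_def)
    qed (rule pr h_meas e_lim e_nonneg)+
    then show ?thesis by (simp add: E_eq)
  qed
  let ?Q = "\<lambda>z. W (fst z) + A0 z + A1 z + 2 * B0 z - 2 * B1 z - 2 * C z"
  have "(?Q \<longlongrightarrow> Dbar2 + (J0 + J0 / g0) + (J1 + J1 / g1) + 2 * 0 - 2 * 0 - 2 * 0) FF"
    by (intro tendsto_intros FF_seq W_lim A0 A1 B0 B1 C)
  then have Q: "(?Q \<longlongrightarrow> F) FF" by (simp add: F_def algebra_simps)
  \<comment> \<open>At the limit point the quotient is continuous. A vanishing denominator, where
    division yields 0, is eventually excluded along \<open>FF\<close>.\<close>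
  have sF: "sqrt F \<noteq> 0" using F_pos by (simp add: F_def)
  let ?t0 = "\<lambda>p. real (n0 p) / (real (n0 p) + nu0 p)" and ?t1 = "\<lambda>p. real (n1 p) / (real (n1 p) + nu1 p)"
  let ?r0 = "\<lambda>p. sqrt ((real (n0 p) + nu0 p) / (real (n0 p) + nu0 p + 1))"
  let ?r1 = "\<lambda>p. sqrt ((real (n1 p) + nu1 p) / (real (n1 p) + nu1 p + 1))"
  let ?R0 = "\<lambda>z. W (fst z) / 2 + (B0 z - B1 z) / 2 + (?t0 (fst z) - 1 / 2) * (B0 z + A0 z - C z) - (B1 z + C z - A1 z) / 2"
  let ?R1 = "\<lambda>z. - W (fst z) / 2 - (B0 z - B1 z) / 2 + (?t1 (fst z) - 1 / 2) * (B1 z + C z - A1 z) - (B0 z + A0 z - C z) / 2"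
  have "(?R0 \<longlongrightarrow> Dbar2 / 2 + (0 - 0) / 2 + (1 / (1 + g0) - 1 / 2) * (0 + (J0 + J0 / g0) - 0)
      - (0 + 0 - (J1 + J1 / g1)) / 2) FF"
    by (intro tendsto_intros FF_seq W_lim A0 A1 B0 B1 C lim0(3)) simp_all
  also have "Dbar2 / 2 + (0 - 0) / 2 + (1 / (1 + g0) - 1 / 2) * (0 + (J0 + J0 / g0) - 0)
      - (0 + 0 - (J1 + J1 / g1)) / 2 = H0"
  proof -
    \<comment> \<open>The posterior weight \<open>1 / (1 + g0)\<close> reduces the noise level
      \<open>J0 + J0 / g0\<close> to its prior part \<open>J0 / g0\<close>. Subtracting half of the
      noise level then leaves \<open>(J0 / g0 - J0) / 2\<close>, which explains the opposite signs
      in \<open>H0\<close>.\<close>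
    have "J0 + J0 / g0 = (1 + g0) * (J0 / g0)" using g(3) by (simp add: field_simps)
    then have "1 / (1 + g0) * (J0 + J0 / g0) = J0 / g0" using g(3) by simp
    then show ?thesis by (simp add: H0_def left_diff_distrib) (simp add: algebra_simps add_divide_distrib diff_divide_distrib)
  qed
  finally have R0: "(?R0 \<longlongrightarrow> H0) FF" .
  have "(?R1 \<longlongrightarrow> - Dbar2 / 2 - (0 - 0) / 2 + (1 / (1 + g1) - 1 / 2) * (0 + 0 - (J1 + J1 / g1))
      - (0 + (J0 + J0 / g0) - 0) / 2) FF"
    by (intro tendsto_intros FF_seq W_lim A0 A1 B0 B1 C lim1(3)) simp_all
  also have "- Dbar2 / 2 - (0 - 0) / 2 + (1 / (1 + g1) - 1 / 2) * (0 + 0 - (J1 + J1 / g1))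
      - (0 + (J0 + J0 / g0) - 0) / 2 = H1"
  proof -
    have "J1 + J1 / g1 = (1 + g1) * (J1 / g1)" using g(4) by (simp add: field_simps)
    then have "1 / (1 + g1) * (J1 + J1 / g1) = J1 / g1" using g(4) by simp
    then show ?thesis by (simp add: H1_def left_diff_distrib) (simp add: algebra_simps add_divide_distrib diff_divide_distrib)
  qed
  finally have R1: "(?R1 \<longlongrightarrow> H1) FF" .
  let ?bc = "\<lambda>i p. bayes_err_class i (Sig p) (n0 p) (n1 p) (nu0 p) (nu1 p) (m0 p) (m1 p) c"
  have n_nu: "0 < real (n0 p) + nu0 p" "0 < real (n1 p) + nu1 p" for p
    using n_pos[of p] nu_pos[of p] by (simp_all add: add_pos_pos)
  note whitened = bayes_err_class_whitened[OF wh m_dim n_nu]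
  have bc0: "((\<lambda>z. ?bc 0 (fst z) (X (fst z) (m0 (fst z)) (fst (snd z))) (X (fst z) (m1 (fst z)) (snd (snd z))))
      \<longlongrightarrow> Phi ((- H0 + c) / sqrt F)) FF"
  proof -
    \<comment> \<open>The posterior correction \<open>?r0\<close> tends to 1 and leaves no trace in
      the limit.\<close>
    have "((\<lambda>z. (- ?R0 z + c) / sqrt (?Q z) * ?r0 (fst z)) \<longlongrightarrow> (- H0 + c) / sqrt F * 1) FF"
      by (intro tendsto_intros R0 Q FF_seq lim0(4) sF)
    from isCont_tendsto_compose[OF isCont_Phi this] show ?thesis
      by (simp only: X_def whitened(1) W_def w_def A0_def A1_def B0_def B1_def C_def mult_1_right)
  qed
  have bc1: "((\<lambda>z. ?bc 1 (fst z) (X (fst z) (m0 (fst z)) (fst (snd z))) (X (fst z) (m1 (fst z)) (snd (snd z))))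
      \<longlongrightarrow> Phi (- ((- H1 + c) / sqrt F))) FF"
  proof -
    have "((\<lambda>z. - ((- ?R1 z + c) / sqrt (?Q z)) * ?r1 (fst z)) \<longlongrightarrow> - ((- H1 + c) / sqrt F) * 1) FF"
      by (intro tendsto_intros R1 Q FF_seq lim1(4) sF)
    from isCont_tendsto_compose[OF isCont_Phi this] show ?thesis
      by (simp only: X_def whitened(2) W_def w_def A0_def A1_def B0_def B1_def C_def mult_1_right)
  qed
  note bm = measurable_bayes_err_class[OF wh m_dim]
  have c0: "(\<lambda>p. ?E p (?bc 0 p)) \<longlonglongrightarrow> Phi ((- H0 + c) / sqrt F)"
    by (intro key bayes_err_class_bounds bm bc0)
  have c1: "(\<lambda>p. ?E p (?bc 1 p)) \<longlonglongrightarrow> Phi (- ((- H1 + c) / sqrt F))"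
    by (intro key bayes_err_class_bounds bm bc1)
  \<comment> \<open>The mixture again has values in [0, 1], so \<open>key\<close> applies to it
    directly, in place of an argument by linearity of \<open>model_expect\<close>.\<close>
  have ct: "(\<lambda>p. ?E p (bayes_err a0 (Sig p) (n0 p) (n1 p) (nu0 p) (nu1 p) (m0 p) (m1 p) c))
      \<longlonglongrightarrow> a0 * Phi ((- H0 + c) / sqrt F) + (1 - a0) * Phi (- ((- H1 + c) / sqrt F))"
  proof (rule key)
    fix p x y
    have "a0 * ?bc 0 p x y + (1 - a0) * ?bc 1 p x y \<le> a0 * 1 + (1 - a0) * 1"
      using a0 bayes_err_class_bounds by (intro add_mono mult_left_mono) auto
    then show "0 \<le> bayes_err a0 (Sig p) (n0 p) (n1 p) (nu0 p) (nu1 p) (m0 p) (m1 p) c x y \<and>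
        bayes_err a0 (Sig p) (n0 p) (n1 p) (nu0 p) (nu1 p) (m0 p) (m1 p) c x y \<le> 1"
      using a0 bayes_err_class_bounds by (simp add: bayes_err_def)
  next
    fix p
    show "(\<lambda>(x, y). bayes_err a0 (Sig p) (n0 p) (n1 p) (nu0 p) (nu1 p) (m0 p) (m1 p) c (vec p x) (vec p y))
        \<in> borel_measurable (Bvec p \<Otimes>\<^sub>M Bvec p)"
      unfolding bayes_err_def case_prod_beta
      by (intro borel_measurable_add borel_measurable_times borel_measurable_const bm[unfolded case_prod_beta])
  next
    show "((\<lambda>z. bayes_err a0 (Sig (fst z)) (n0 (fst z)) (n1 (fst z)) (nu0 (fst z)) (nu1 (fst z)) (m0 (fst z)) (m1 (fst z)) c
        (X (fst z) (m0 (fst z)) (fst (snd z))) (X (fst z) (m1 (fst z)) (snd (snd z))))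
      \<longlongrightarrow> a0 * Phi ((- H0 + c) / sqrt F) + (1 - a0) * Phi (- ((- H1 + c) / sqrt F))) FF"
      unfolding bayes_err_def by (intro tendsto_intros bc0 bc1)
  qed
  have "- ((- H1 + c) / sqrt F) = (H1 - c) / sqrt F"
    by (simp add: minus_divide_left)
  with c0 c1 ct show ?thesis
    unfolding Let_def c_def[symmetric] H0_def[symmetric] H1_def[symmetric] F_def[symmetric]
    by simp
qed

end
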